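(* Let $\Gamma$ be a countable discrete group, let $(\Gamma_n)_{n\ge 1}$ be a sequence of discrete groups, and let $\varphi_n : \Gamma \to \Gamma_n$ be group homomorphisms with kernels $K_n = \ker \varphi_n$. For $f \in L^1(\Gamma)$ set $f_n = \varphi_{n*}(f) \in L^1(\Gamma_n)$. Assume that $K_n \to e$. Then for every $f \in L^1(\Gamma)$ $$\det\nolimits_{\mathcal{N}\Gamma} f \;\ge\; \limsup_{n\to\infty} \det\nolimits_{\mathcal{N}\Gamma_n} f_n ,$$ and if $f \in L^1(\Gamma)^{\times}$, then equality holds in the form $$\det\nolimits_{\mathcal{N}\Gamma} f \;=\; \lim_{n\to\infty} \det\nolimits_{\mathcal{N}\Gamma_n} f_n .$$
   Context: For a discrete group $\Gamma$ and $p=1,2$, elements of $L^p(\Gamma)$ are written as formal series $\sum_{\gamma\in\Gamma} x_\gamma \gamma$ with $x_\gamma\in\mathbb{C}$, $\sum_\gamma |x_\gamma|^p<\infty$; $\Gamma$ acts isometrically on $L^p(\Gamma)$ by left and right multiplication. $L^1(\Gamma)$ is a unital Banach $*$-algebra under convolution, and $L^1(\Gamma)^\times$ is its group of units. The von Neumann algebra $\mathcal{N}\Gamma$ is the algebra of bounded operators $A: L^2(\Gamma)\to L^2(\Gamma)$ that commute with left multiplication by every $\gamma\in\Gamma$. Its canonical trace is $\tau_{\mathcal{N}\Gamma}(A) = (A e, e)$, where $e\in\Gamma\subset L^2(\Gamma)$ is the unit element. Fuglede–Kadison determinant: for invertible $A\in\mathcal{N}\Gamma$, $\det_{\mathcal{N}\Gamma}A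 = \exp \tau_{\mathcal{N}\Gamma}(\log|A|)$ with $|A|=(A^*A)^{1/2}$; for arbitrary $A\in \mathcal{N}\Gamma$, $\det_{\mathcal{N}\Gamma}A=\lim_{\varepsilon\to0+}\det_{\mathcal{N}\Gamma}(|A|+\varepsilon)\in[0,\infty)$. $L^1(\Gamma)$ is viewed as a subalgebra of $\mathcal{N}\Gamma$ via the injective homomorphism $r: L^1(\Gamma)\to\mathcal{N}\Gamma$, $r(\sum_\gamma f_\gamma\gamma)=\sum_\gamma f_\gamma R_{\gamma^{-1}}$, where $R_\gamma(x)=x\gamma$ on $L^2(\Gamma)$. So $\det_{\mathcal{N}\Gamma} f$ means $\det_{\mathcal{N}\Gamma} r(f)$ for $f\in L^1(\Gamma)$. For a homomorphism $\varphi:\Gamma\to\Gamma'$ of discrete groups, $\varphi_*:L^1(\Gamma)\to L^1(\Gamma')$ is defined by $\varphi_*(\sum_\gamma f_\gamma\gamma)=\sum_\gamma f_\gamma\varphi(\gamma)$. For a sequence $(K_n)$ of normal subgroups of $\Gamma$, $K_n\to e$ means that $e$ is the only element of $\Gamma$ contained in infinitely many $K_n$; equivalently, for every finite subset $Q\subset\Gamma$ one has $K_n\cap Q\subset\{e\}$ for all sufficiently large $n$. *)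

theory Defs
  imports "HOL-Analysis.Analysis" "HOL-Algebra.Coset"
begin

text \<open>A formal series over a group is its coefficient function, which vanishes outside the
  carrier, so that equality of series is equality of functions.\<close>

definition Lp :: "nat \<Rightarrow> ('g, 'm) monoid_scheme \<Rightarrow> ('g \<Rightarrow> complex) set" where
  "Lp p G = {x. (\<forall>g. g \<notin> carrier G \<longrightarrow> x g = 0) \<and> (\<lambda>g. norm (x g) ^ p) summable_on carrier G}"

definition delta :: "'g \<Rightarrow> 'g \<Rightarrow> complex" where
  "delta a = (\<lambda>g. if g = a then 1 else 0)"

definition l2_inner :: "('g, 'm) monoid_scheme \<Rightarrow> ('g \<Rightarrow> complex) \<Rightarrow> ('g \<Rightarrow> complex) \<Rightarrow> complex" where
  "l2_inner G x y = (\<Sum>\<^sub>\<infinity>g\<in>carrier G. x g * cnj (y g))"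

definition l2_norm :: "('g, 'm) monoid_scheme \<Rightarrow> ('g \<Rightarrow> complex) \<Rightarrow> real" where
  "l2_norm G x = sqrt (\<Sum>\<^sub>\<infinity>g\<in>carrier G. (norm (x g))\<^sup>2)"

text \<open>The series \<open>a x\<close> and \<open>x a\<close>.\<close>

definition left_mult :: "('g, 'm) monoid_scheme \<Rightarrow> 'g \<Rightarrow> ('g \<Rightarrow> complex) \<Rightarrow> 'g \<Rightarrow> complex" where
  "left_mult G a x = (\<lambda>g. if g \<in> carrier G then x (inv\<^bsub>G\<^esub> a \<otimes>\<^bsub>G\<^esub> g) else 0)"

definition right_mult :: "('g, 'm) monoid_scheme \<Rightarrow> 'g \<Rightarrow> ('g \<Rightarrow> complex) \<Rightarrow> 'g \<Rightarrow> complex" where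
  "right_mult G a x = (\<lambda>g. if g \<in> carrier G then x (g \<otimes>\<^bsub>G\<^esub> inv\<^bsub>G\<^esub> a) else 0)"

text \<open>The multiplicative monoid of the convolution algebra.\<close>

definition convolution ::
    "('g, 'm) monoid_scheme \<Rightarrow> ('g \<Rightarrow> complex) \<Rightarrow> ('g \<Rightarrow> complex) \<Rightarrow> 'g \<Rightarrow> complex" where
  "convolution G f h =
     (\<lambda>g. if g \<in> carrier G then \<Sum>\<^sub>\<infinity>b\<in>carrier G. f b * h (inv\<^bsub>G\<^esub> b \<otimes>\<^bsub>G\<^esub> g) else 0)"

definition L1_monoid :: "('g, 'm) monoid_scheme \<Rightarrow> ('g \<Rightarrow> complex) monoid" where
  "L1_monoid G = \<lparr>carrier = Lp 1 G, mult = convolution G, one = delta \<one>\<^bsub>G\<^esub>\<rparr>"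

definition pushforward ::
    "('g, 'm) monoid_scheme \<Rightarrow> ('g \<Rightarrow> 'h) \<Rightarrow> ('g \<Rightarrow> complex) \<Rightarrow> 'h \<Rightarrow> complex" where
  "pushforward G \<phi> f = (\<lambda>h. \<Sum>\<^sub>\<infinity>g\<in>{g \<in> carrier G. \<phi> g = h}. f g)"

text \<open>Operators are functions on the Hilbert space \<open>Lp 2 G\<close>, made extensional outside it so that
  an operator is determined by its values on the Hilbert space.\<close>

type_synonym 'g l2_op = "('g \<Rightarrow> complex) \<Rightarrow> ('g \<Rightarrow> complex)"

definition bounded_ops :: "('g, 'm) monoid_scheme \<Rightarrow> 'g l2_op set" where
  "bounded_ops G = {A \<in> Lp 2 G \<rightarrow>\<^sub>E Lp 2 G.
     (\<forall>x\<in>Lp 2 G. \<forall>y\<in>Lp 2 G. A (\<lambda>g. x g + y g) = (\<lambda>g. A x g + A y g)) \<and>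
     (\<forall>c. \<forall>x\<in>Lp 2 G. A (\<lambda>g. c * x g) = (\<lambda>g. c * A x g)) \<and>
     (\<exists>C. \<forall>x\<in>Lp 2 G. l2_norm G (A x) \<le> C * l2_norm G x)}"

definition vN :: "('g, 'm) monoid_scheme \<Rightarrow> 'g l2_op set" where
  "vN G = {A \<in> bounded_ops G.
     \<forall>a\<in>carrier G. \<forall>x\<in>Lp 2 G. A (left_mult G a x) = left_mult G a (A x)}"

definition vN_trace :: "('g, 'm) monoid_scheme \<Rightarrow> 'g l2_op \<Rightarrow> complex" where
  "vN_trace G A = l2_inner G (A (delta \<one>\<^bsub>G\<^esub>)) (delta \<one>\<^bsub>G\<^esub>)"

definition op_norm :: "('g, 'm) monoid_scheme \<Rightarrow> 'g l2_op \<Rightarrow> real" where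
  "op_norm G A = (SUP x\<in>{x \<in> Lp 2 G. l2_norm G x \<le> 1}. l2_norm G (A x))"

definition op_id :: "('g, 'm) monoid_scheme \<Rightarrow> 'g l2_op" where
  "op_id G = (\<lambda>x\<in>Lp 2 G. x)"

definition op_mult :: "('g, 'm) monoid_scheme \<Rightarrow> 'g l2_op \<Rightarrow> 'g l2_op \<Rightarrow> 'g l2_op" where
  "op_mult G A B = compose (Lp 2 G) A B"

definition op_diff :: "('g, 'm) monoid_scheme \<Rightarrow> 'g l2_op \<Rightarrow> 'g l2_op \<Rightarrow> 'g l2_op" where
  "op_diff G A B = (\<lambda>x\<in>Lp 2 G. \<lambda>g. A x g - B x g)"

text \<open>The operator \<open>A + c\<close> for a scalar \<open>c\<close>.\<close>

definition op_shift :: "('g, 'm) monoid_scheme \<Rightarrow> 'g l2_op \<Rightarrow> complex \<Rightarrow> 'g l2_op" where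
  "op_shift G A c = (\<lambda>x\<in>Lp 2 G. \<lambda>g. A x g + c * x g)"

definition op_poly :: "('g, 'm) monoid_scheme \<Rightarrow> real poly \<Rightarrow> 'g l2_op \<Rightarrow> 'g l2_op" where
  "op_poly G p A = (\<lambda>x\<in>Lp 2 G. \<lambda>g. \<Sum>i\<le>degree p. of_real (coeff p i) * (A ^^ i) x g)"

definition op_adjoint :: "('g, 'm) monoid_scheme \<Rightarrow> 'g l2_op \<Rightarrow> 'g l2_op" where
  "op_adjoint G A = (THE B. B \<in> vN G \<and>
     (\<forall>x\<in>Lp 2 G. \<forall>y\<in>Lp 2 G. l2_inner G (A x) y = l2_inner G x (B y)))"

definition vN_invertible :: "('g, 'm) monoid_scheme \<Rightarrow> 'g l2_op \<Rightarrow> bool" where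
  "vN_invertible G A \<longleftrightarrow>
     A \<in> vN G \<and> (\<exists>B\<in>vN G. op_mult G A B = op_id G \<and> op_mult G B A = op_id G)"

definition op_spectrum :: "('g, 'm) monoid_scheme \<Rightarrow> 'g l2_op \<Rightarrow> complex set" where
  "op_spectrum G A = {z. \<not> vN_invertible G (op_shift G A (- z))}"

text \<open>Continuous functional calculus for a self-adjoint \<open>A\<close> (whose spectrum is real and compact)
  and a real function \<open>u\<close> continuous on the spectrum: the norm limit of \<open>p n (A)\<close> for
  polynomials \<open>p n\<close> converging to \<open>u\<close> uniformly on the spectrum. Such polynomials exist by the
  Weierstrass theorem and the limit does not depend on their choice.\<close>

definition fun_calc :: "('g, 'm) monoid_scheme \<Rightarrow> (real \<Rightarrow> real) \<Rightarrow> 'g l2_op \<Rightarrow> 'g l2_op" where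
  "fun_calc G u A = (THE B. B \<in> vN G \<and> (\<exists>p :: nat \<Rightarrow> real poly.
     uniform_limit {t. complex_of_real t \<in> op_spectrum G A} (\<lambda>n. poly (p n)) u sequentially \<and>
     (\<lambda>n. op_norm G (op_diff G (op_poly G (p n) A) B)) \<longlonglongrightarrow> 0))"

definition op_abs :: "('g, 'm) monoid_scheme \<Rightarrow> 'g l2_op \<Rightarrow> 'g l2_op" where
  "op_abs G A = fun_calc G sqrt (op_mult G (op_adjoint G A) A)"

text \<open>The Fuglede--Kadison determinant, first for invertible elements of \<open>vN G\<close>, then for
  arbitrary ones. The trace of the self-adjoint operator \<open>log |A|\<close> is real, so taking its real part
  only changes the type. On invertible elements both definitions agree.\<close>

definition fk_det_invertible :: "('g, 'm) monoid_scheme \<Rightarrow> 'g l2_op \<Rightarrow> real" where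
  "fk_det_invertible G A = exp (Re (vN_trace G (fun_calc G ln (op_abs G A))))"

definition fk_det :: "('g, 'm) monoid_scheme \<Rightarrow> 'g l2_op \<Rightarrow> real" where
  "fk_det G A =
     Lim (at_right 0) (\<lambda>\<epsilon>. fk_det_invertible G (op_shift G (op_abs G A) (complex_of_real \<epsilon>)))"

text \<open>The embedding of \<open>Lp 1 G\<close> into \<open>vN G\<close>. The series converges in operator norm and hence
  coefficientwise.\<close>

definition L1_op :: "('g, 'm) monoid_scheme \<Rightarrow> ('g \<Rightarrow> complex) \<Rightarrow> 'g l2_op" where
  "L1_op G f = (\<lambda>x\<in>Lp 2 G. \<lambda>g. \<Sum>\<^sub>\<infinity>a\<in>carrier G. f a * right_mult G (inv\<^bsub>G\<^esub> a) x g)"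

definition subgroups_tend_to_one :: "('g, 'm) monoid_scheme \<Rightarrow> (nat \<Rightarrow> 'g set) \<Rightarrow> bool" where
  "subgroups_tend_to_one G K \<longleftrightarrow> {g \<in> carrier G. infinite {n. n \<ge> 1 \<and> g \<in> K n}} = {\<one>\<^bsub>G\<^esub>}"

end

theory Submission
  imports Defs "HOL-Computational_Algebra.Fundamental_Theorem_Algebra"
begin

text \<open>Let \<open>r = \<parallel>f\<parallel>\<^sub>1\<close>. All operators \<open>H\<^sub>n = f\<^sub>n\<^sup>* f\<^sub>n\<close> and \<open>H = f\<^sup>* f\<close> have their spectrum in
  \<open>[0, r\<^sup>2]\<close>. Since \<open>f\<^sub>n\<close> acts through a representation of \<open>L\<^sup>1(\<Gamma>)\<close>, the power \<open>H\<^sub>n\<^sup>i\<close> is the image of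
  one element \<open>x\<^sub>i\<close> of \<open>L\<^sup>1(\<Gamma>)\<close> and its trace is the sum of \<open>x\<^sub>i\<close> over \<open>K\<^sub>n\<close>, which tends to
  \<open>x\<^sub>i(e)\<close>, the trace of \<open>H\<^sup>i\<close>. By the Weierstrass theorem the traces of \<open>u(H\<^sub>n)\<close> tend to that of
  \<open>u(H)\<close> for every continuous \<open>u\<close> on \<open>[0, r\<^sup>2]\<close>. With \<open>u(t) = log (\<surd>t + \<epsilon>)\<close> this bounds the upper
  limit of the determinants by \<open>det (|f| + \<epsilon>)\<close> for every \<open>\<epsilon> > 0\<close>. If \<open>f\<close> is a unit, all spectra stay
  above \<open>\<parallel>f\<^sup>-\<^sup>1\<parallel>\<^sub>1\<^sup>-\<^sup>2\<close>, and \<open>u(t) = log \<surd>t\<close> gives equality.\<close>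

subsection \<open>Real polynomials\<close>

text \<open>The determinant is assembled from definite descriptions (\<open>op_adjoint\<close>,
  \<open>fun_calc\<close>, \<open>Lim\<close>), so each of them has to be evaluated before any
  estimate can start. This is the reason for developing a continuous functional calculus with
  existence, uniqueness and composition. Its norm estimate rests on one fact: a self-adjoint
  operator has plus or minus its norm in its spectrum. The functional that sends \<open>u\<close> to
  the trace of \<open>u(H)\<close> stands in for the spectral measure; it is monotone and bounded by
  the sup norm of \<open>u\<close>. The obstacle is that log is unbounded at 0. Convergence of
  moments does not prevent spectral mass of the approximating operators from drifting towards 0,
  which can only make their determinants smaller. Adding \<epsilon> removes the singularity and only
  increases the determinant, so one inequality survives if \<epsilon> tends to 0 after
  \<open>n\<close> has gone to infinity. Real Hilbert spaces are used throughout; complex linearity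
  is commutation with multiplication by the imaginary unit.\<close>

lemma map_poly_of_real_add:
  "map_poly complex_of_real (p + q) = map_poly of_real p + map_poly of_real q"
  by (rule poly_eqI) (simp add: coeff_map_poly)

lemma map_poly_of_real_mult:
  "map_poly complex_of_real (p * q) = map_poly of_real p * map_poly of_real q"
  by (rule poly_eqI) (simp add: coeff_map_poly coeff_mult)

lemma poly_map_poly_of_real:
  "poly (map_poly complex_of_real p) (of_real t) = of_real (poly p t)"
  by (induction p) (simp_all add: map_poly_pCons)

text \<open>The quadratic is (X - z)(X - cnj z). The remainder of \<open>p\<close> modulo it is real
  of degree at most one and vanishes at the nonreal \<open>z\<close>, hence is zero. This lets
  polynomials be factored over the reals, the scalars of the operator algebras below.\<close>

lemma quadratic_dvd:
  fixes p :: "real poly" and z :: complex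
  assumes "poly (map_poly of_real p) z = 0" "Im z \<noteq> 0"
  shows "[:(Re z)\<^sup>2 + (Im z)\<^sup>2, - 2 * Re z, 1:] dvd p"
proof -
  define d where "d = [:(Re z)\<^sup>2 + (Im z)\<^sup>2, - 2 * Re z, 1:]"
  define r where "r = p mod d"
  have d0: "d \<noteq> 0" "degree d = 2" by (auto simp: d_def)
  have r2: "degree r < 2" using d0 degree_mod_less'[of d p] unfolding r_def by (cases "p mod d = 0") auto
  then obtain u v where r: "r = [:u, v:]"
    by (metis Suc_inject degree_eq_zeroE degree_pCons_eq_if less_2_cases_iff One_nat_def pCons_cases pCons_0_0 zero_neq_one)
  have "poly (map_poly of_real d) z = 0"
    by (simp add: d_def map_poly_pCons complex_eq_iff power2_eq_square algebra_simps)
  moreover have "p = d * (p div d) + r" by (simp add: r_def)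
  then have "map_poly complex_of_real p = map_poly of_real d * map_poly of_real (p div d) + map_poly of_real r"
    by (metis map_poly_of_real_add map_poly_of_real_mult)
  ultimately have "poly (map_poly complex_of_real r) z = 0" using assms(1) by simp
  then have "of_real u + z * of_real v = (0::complex)"
    by (simp add: r map_poly_pCons)
  then have "u = 0 \<and> v = 0" using assms(2) by (auto simp: complex_eq_iff)
  then have "r = 0" by (simp add: r)
  then show ?thesis by (auto simp: r_def d_def dvd_eq_mod_eq_0)
qed

lemma real_polynomial_function_poly:
  assumes "real_polynomial_function (g :: real \<Rightarrow> real)"
  obtains p where "g = poly p"
proof -
  obtain a n where "g = (\<lambda>x. \<Sum>i\<le>n. a i * x ^ i)"
    using assms real_polynomial_function_iff_sum by auto
  then have "g = poly (\<Sum>i\<le>n. monom (a i) i)"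
    by (simp add: fun_eq_iff poly_sum poly_monom)
  then show ?thesis using that by blast
qed

text \<open>The explicit rate is kept beside the uniform limit for the Cauchy estimate in
  \<open>calculus_exists\<close> and the error bound in \<open>calculus_compose\<close>.\<close>

lemma uniform_poly_approximation:
  fixes u :: "real \<Rightarrow> real"
  assumes "compact I" "continuous_on I u"
  obtains p where "\<And>n t. t \<in> I \<Longrightarrow> \<bar>u t - poly (p n) t\<bar> < inverse (Suc n)"
    and "uniform_limit I (\<lambda>n. poly (p n)) u sequentially"
proof -
  have "\<exists>p. \<forall>t\<in>I. \<bar>u t - poly p t\<bar> < inverse (Suc n)" for n
  proof -
    obtain g where g: "real_polynomial_function g" "\<And>t. t \<in> I \<Longrightarrow> \<bar>u t - g t\<bar> < inverse (Suc n)"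
      using Stone_Weierstrass_real_polynomial_function[OF assms, of "inverse (Suc n)"] by auto
    then show ?thesis using real_polynomial_function_poly[OF g(1)] by metis
  qed
  then obtain p where p: "\<And>n t. t \<in> I \<Longrightarrow> \<bar>u t - poly (p n) t\<bar> < inverse (Suc n)" by metis
  moreover have "uniform_limit I (\<lambda>n. poly (p n)) u sequentially"
  proof (rule uniform_limitI)
    fix \<epsilon> :: real assume "\<epsilon> > 0"
    then have "\<forall>\<^sub>F n in sequentially. inverse (real (Suc n)) < \<epsilon>"
      using LIMSEQ_inverse_real_of_nat by (simp add: order_tendsto_iff)
    then show "\<forall>\<^sub>F n in sequentially. \<forall>t\<in>I. dist (poly (p n) t) (u t) < \<epsilon>"
      by eventually_elim (metis p dist_commute dist_real_def less_trans)
  qed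
  ultimately show ?thesis using that by blast
qed

lemma poly_fun:
  fixes p q :: "real poly"
  shows
  "poly [:c:] = (\<lambda>_. c::real)" "poly [:0, 1:] = (\<lambda>t. t::real)"
  "poly (p + q) = (\<lambda>t. poly p t + poly q t)" "poly (p * q) = (\<lambda>t. poly p t * poly q t)"
  by (auto simp: fun_eq_iff)

subsection \<open>Operator algebras on a real Hilbert space\<close>

text \<open>On \<open>ell2\<close> the real inner product is the real part of the Hermitian one. For
  an operator that commutes with multiplication by the imaginary unit, this symmetry is equivalent
  to self-adjointness in the Hermitian sense.\<close>

definition selfadj :: "('a::real_inner \<Rightarrow>\<^sub>L 'a) \<Rightarrow> bool" where
  "selfadj T \<longleftrightarrow> (\<forall>x y. blinfun_apply T x \<bullet> y = x \<bullet> blinfun_apply T y)"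

lemma selfadjD: "selfadj T \<Longrightarrow> blinfun_apply T x \<bullet> y = x \<bullet> blinfun_apply T y"
  by (simp add: selfadj_def)

lemma selfadj_add: "selfadj S \<Longrightarrow> selfadj T \<Longrightarrow> selfadj (S + T)"
  by (simp add: selfadj_def blinfun.add_left inner_add_left inner_add_right)

lemma selfadj_scaleR: "selfadj S \<Longrightarrow> selfadj (c *\<^sub>R S)"
  by (simp add: selfadj_def blinfun.scaleR_left)

lemma selfadj_diff: "selfadj S \<Longrightarrow> selfadj T \<Longrightarrow> selfadj (S - T)"
  by (simp add: selfadj_def blinfun.diff_left inner_diff_left inner_diff_right)

lemma selfadj_compose:
  "selfadj S \<Longrightarrow> selfadj T \<Longrightarrow> S o\<^sub>L T = T o\<^sub>L S \<Longrightarrow> selfadj (S o\<^sub>L T)"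
  unfolding selfadj_def by (metis blinfun_apply_blinfun_compose)

lemma closed_selfadj: "closed {T :: 'a::real_inner \<Rightarrow>\<^sub>L 'a. selfadj T}"
  unfolding selfadj_def
  by (intro closed_Collect_all closed_Collect_eq continuous_intros)

interpretation blinfun_compose: bounded_bilinear "(o\<^sub>L)"
  by (rule bounded_bilinear_blinfun_compose)

lemma blinfun_compose_assoc: "(S o\<^sub>L T) o\<^sub>L U = S o\<^sub>L (T o\<^sub>L U)"
  by (rule blinfun_eqI) simp

text \<open>The unit of the algebra is a projection rather than the identity, since the Hilbert
  space of a group is embedded into the square-summable functions on a whole type.\<close>

locale op_algebra =
  fixes A :: "('a::{real_inner,banach} \<Rightarrow>\<^sub>L 'a) set" and e :: "'a \<Rightarrow>\<^sub>L 'a"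
  assumes closed_A: "closed A"
    and subspace_A: "subspace A"
    and compose_A: "S \<in> A \<Longrightarrow> T \<in> A \<Longrightarrow> S o\<^sub>L T \<in> A"
    and unit_A: "e \<in> A"
    and unit_left: "T \<in> A \<Longrightarrow> e o\<^sub>L T = T"
    and unit_right: "T \<in> A \<Longrightarrow> T o\<^sub>L e = T"
    and selfadj_unit: "selfadj e"
    and unit_nonzero: "e \<noteq> 0"
begin

lemma add_A: "S \<in> A \<Longrightarrow> T \<in> A \<Longrightarrow> S + T \<in> A"
  and scaleR_A: "S \<in> A \<Longrightarrow> c *\<^sub>R S \<in> A"
  and diff_A: "S \<in> A \<Longrightarrow> T \<in> A \<Longrightarrow> S - T \<in> A"
  and zero_A: "0 \<in> A"
  using subspace_A by (auto simp: subspace_add subspace_scale subspace_diff subspace_0)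

lemma unit_apply: "T \<in> A \<Longrightarrow> e (T x) = T x" "T \<in> A \<Longrightarrow> T (e x) = T x"
  by (metis unit_left blinfun_apply_blinfun_compose, metis unit_right blinfun_apply_blinfun_compose)

lemma inner_unit: "T \<in> A \<Longrightarrow> T x \<bullet> e x = T x \<bullet> x"
  by (metis selfadjD selfadj_unit unit_apply(1))

lemma norm_unit_apply: "norm (e x) \<le> norm x"
proof -
  have "norm (e x) * norm (e x) = e x \<bullet> x"
    using inner_unit[OF unit_A, of x] by (simp flip: power2_eq_square power2_norm_eq_inner)
  also have "\<dots> \<le> norm (e x) * norm x" by (rule norm_cauchy_schwarz)
  finally show ?thesis
    by (metis mult_le_cancel_left_pos norm_ge_zero order_le_less)
qed

text \<open>The unit \<open>e\<close> is a contraction, so a bound relative to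
  \<open>norm (e x)\<close> is the stronger one. Estimates obtained from quadratic forms come in
  this shape.\<close>

lemma norm_le_unitI:
  assumes "T \<in> A" "0 \<le> k" "\<And>x. norm (T x) \<le> k * norm (e x)"
  shows "norm T \<le> k"
  by (rule norm_blinfun_bound[OF assms(2)])
     (meson assms(2,3) mult_left_mono norm_unit_apply order_trans)

section \<open>Invertibility and the norm as a spectral value\<close>

definition invertible :: "('a \<Rightarrow>\<^sub>L 'a) \<Rightarrow> bool" where
  "invertible T \<longleftrightarrow> (\<exists>R\<in>A. T o\<^sub>L R = e \<and> R o\<^sub>L T = e)"

lemma invertible_compose:
  assumes "S \<in> A" "T \<in> A" "invertible S" "invertible T"
  shows "invertible (S o\<^sub>L T)"
proof -
  obtain S' where S': "S' \<in> A" "S o\<^sub>L S' = e" "S' o\<^sub>L S = e" using assms(3) invertible_def by auto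
  obtain T' where T': "T' \<in> A" "T o\<^sub>L T' = e" "T' o\<^sub>L T = e" using assms(4) invertible_def by auto
  have "(S o\<^sub>L T) o\<^sub>L (T' o\<^sub>L S') = S o\<^sub>L ((T o\<^sub>L T') o\<^sub>L S')"
    by (simp add: blinfun_compose_assoc)
  moreover have "(T' o\<^sub>L S') o\<^sub>L (S o\<^sub>L T) = T' o\<^sub>L ((S' o\<^sub>L S) o\<^sub>L T)"
    by (simp add: blinfun_compose_assoc)
  ultimately show ?thesis
    using S' T' assms compose_A unit_left unfolding invertible_def by metis
qed

lemma invertible_scaleR:
  assumes "c \<noteq> 0" "invertible (c *\<^sub>R T)"
  shows "invertible T"
proof -
  obtain R where "R \<in> A" "c *\<^sub>R T o\<^sub>L R = e" "R o\<^sub>L c *\<^sub>R T = e"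
    using assms(2) invertible_def by auto
  then show ?thesis unfolding invertible_def
    by (intro bexI[of _ "c *\<^sub>R R"])
       (auto simp: blinfun_compose.scaleR_left blinfun_compose.scaleR_right scaleR_A)
qed

lemma invertible_unit: "invertible e"
  unfolding invertible_def using unit_A unit_left by blast

primrec power_op :: "('a \<Rightarrow>\<^sub>L 'a) \<Rightarrow> nat \<Rightarrow> ('a \<Rightarrow>\<^sub>L 'a)" where
  "power_op T 0 = e"
| "power_op T (Suc n) = T o\<^sub>L power_op T n"

lemma power_op_A: "T \<in> A \<Longrightarrow> power_op T n \<in> A"
  by (induction n) (auto simp: unit_A compose_A)

lemma power_op_commute: "T \<in> A \<Longrightarrow> power_op T n o\<^sub>L T = T o\<^sub>L power_op T n"
proof (induction n)
  case 0 then show ?case by (simp add: unit_left unit_right)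
next
  case (Suc n)
  have "power_op T (Suc n) o\<^sub>L T = T o\<^sub>L (power_op T n o\<^sub>L T)"
    by (simp add: blinfun_compose_assoc)
  then show ?case using Suc by simp
qed

lemma norm_power_op: "norm T \<le> r \<Longrightarrow> norm (power_op T n) \<le> r ^ n"
proof (induction n)
  case 0
  show ?case using norm_unit_apply by (auto intro!: norm_blinfun_bound)
next
  case (Suc n)
  have "norm (power_op T (Suc n)) \<le> norm T * norm (power_op T n)" by (simp add: norm_blinfun_compose)
  also have "\<dots> \<le> r * r ^ n"
    using Suc order_trans[OF norm_ge_zero Suc.prems] by (intro mult_mono) auto
  finally show ?case by simp
qed

text \<open>Neumann series: the partial sums telescope against \<open>e - D\<close>, and closedness
  of \<open>A\<close> keeps their limit, the inverse, inside the algebra.\<close>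

lemma invertible_unit_minus:
  assumes D: "D \<in> A" and r: "norm D \<le> r" "r < 1"
  shows "invertible (e - D)"
proof -
  have "summable (\<lambda>n. power_op D n)"
    using r order_trans[OF norm_ge_zero r(1)]
    by (intro summable_comparison_test[OF _ summable_geometric[of r]]) (auto intro: norm_power_op)
  then have R: "(\<lambda>N. \<Sum>n<N. power_op D n) \<longlonglongrightarrow> (\<Sum>n. power_op D n)" (is "_ \<longlonglongrightarrow> ?R") by (rule summable_LIMSEQ)
  have partA: "(\<Sum>n<N. power_op D n) \<in> A" for N
    by (simp add: subspace_sum[OF subspace_A] power_op_A D)
  have RA: "?R \<in> A" using closed_sequentially[OF closed_A, of "\<lambda>N. \<Sum>n<N. power_op D n"] partA R by blast
  have left: "(e - D) o\<^sub>L (\<Sum>n<N. power_op D n) = e - power_op D N" for N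
  proof (induction N)
    case (Suc N)
    then show ?case
      by (simp add: blinfun_compose.add_right blinfun_compose.diff_left unit_left power_op_A D)
  qed simp
  have right: "(\<Sum>n<N. power_op D n) o\<^sub>L (e - D) = (e - D) o\<^sub>L (\<Sum>n<N. power_op D n)" for N
    by (simp add: blinfun_compose.sum_left blinfun_compose.sum_right blinfun_compose.diff_left
        blinfun_compose.diff_right unit_left unit_right power_op_A D power_op_commute sum_subtractf)
  have pw0: "(\<lambda>N. power_op D N) \<longlonglongrightarrow> 0"
    by (rule summable_LIMSEQ_zero[OF \<open>summable (\<lambda>n. power_op D n)\<close>])
  have lim: "(\<lambda>N. e - power_op D N) \<longlonglongrightarrow> e" using tendsto_diff[OF tendsto_const pw0, of e] by simp
  have "(\<lambda>N. ((e - D) o\<^sub>L (\<Sum>n<N. power_op D n))) \<longlonglongrightarrow> ((e - D) o\<^sub>L ?R)"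
    by (intro blinfun_compose.tendsto tendsto_const R)
  moreover have "(\<lambda>N. (\<Sum>n<N. power_op D n) o\<^sub>L (e - D)) \<longlonglongrightarrow> (?R o\<^sub>L (e - D))"
    by (intro blinfun_compose.tendsto tendsto_const R)
  ultimately have "(e - D) o\<^sub>L ?R = e" "?R o\<^sub>L (e - D) = e"
    using lim LIMSEQ_unique unfolding right left by blast+
  then show ?thesis using RA invertible_def by blast
qed

text \<open>Lax-Milgram argument: for a suitable \<open>t > 0\<close> the operator
  \<open>e - t *\<^sub>R T\<close> is a strict contraction, so \<open>t *\<^sub>R T\<close> is
  invertible by the Neumann series.\<close>

lemma invertible_coercive:
  assumes T: "T \<in> A" and c: "c > 0" and le: "\<And>x. c * (norm (e x))\<^sup>2 \<le> T x \<bullet> x"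
  shows "invertible T"
proof -
  \<comment> \<open>Adding \<open>c\<close> to the norm makes \<open>M\<close> positive and at least
    \<open>c\<close>, so that \<open>k\<close> below lies in [0, 1).\<close>
  define M where "M = norm T + c"
  have M: "M > 0" "c \<le> M" "norm T \<le> M" using c by (auto simp: M_def add_nonneg_pos)
  \<comment> \<open>The minimiser of 1 - 2 t c + t^2 M^2, the bound for the squared norm of
    \<open>D\<close>; the minimum is \<open>k\<close>.\<close>
  define t where "t = c / M\<^sup>2"
  have t: "t > 0" using c M by (simp add: t_def)
  define k where "k = 1 - c\<^sup>2 / M\<^sup>2"
  have k: "0 \<le> k" "k < 1" using c M by (auto simp: k_def divide_simps power_mono)
  define D where "D = e - t *\<^sub>R T"
  have DA: "D \<in> A" by (simp add: D_def diff_A unit_A scaleR_A T)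
  have "norm D \<le> sqrt k"
  proof (rule norm_le_unitI[OF DA])
    fix x
    have "norm (T x) \<le> M * norm (e x)"
      by (metis M(3) norm_blinfun mult_right_mono norm_ge_zero order_trans unit_apply(2)[OF T])
    then have Tx: "(norm (T x))\<^sup>2 \<le> M\<^sup>2 * (norm (e x))\<^sup>2"
      by (metis norm_ge_zero power_mono power_mult_distrib)
    have "(norm (D x))\<^sup>2 = (norm (e x))\<^sup>2 - 2 * t * (T x \<bullet> x) + t\<^sup>2 * (norm (T x))\<^sup>2"
      by (simp add: D_def blinfun.diff_left blinfun.scaleR_left power2_norm_eq_inner inner_diff_left
         inner_diff_right inner_commute[of "e x" "T x"] inner_unit[OF T] algebra_simps) (simp add: power2_eq_square)
    also have "\<dots> \<le> (norm (e x))\<^sup>2 - 2 * t * (c * (norm (e x))\<^sup>2) + t\<^sup>2 * (M\<^sup>2 * (norm (e x))\<^sup>2)"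
      using t le[of x] Tx by (intro add_mono diff_mono mult_left_mono) auto
    also have "\<dots> = (1 - 2 * t * c + t\<^sup>2 * M\<^sup>2) * (norm (e x))\<^sup>2" by (simp add: algebra_simps)
    also have "1 - 2 * t * c + t\<^sup>2 * M\<^sup>2 = k"
      using M by (simp add: t_def k_def power2_eq_square field_simps)
    also have "k * (norm (e x))\<^sup>2 = (sqrt k * norm (e x))\<^sup>2" using k by (simp add: power_mult_distrib)
    finally show "norm (D x) \<le> sqrt k * norm (e x)"
      using k by (intro power2_le_imp_le[of "norm (D x)"]) auto
  qed (use k in auto)
  then have "invertible (e - D)" using k by (intro invertible_unit_minus[OF DA, of "sqrt k"]) auto
  then have "invertible (t *\<^sub>R T)" by (simp add: D_def)
  then show ?thesis using t by (intro invertible_scaleR[of t T]) auto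
qed

text \<open>Otherwise \<open>T\<^sup>2 - \<parallel>T\<parallel>\<^sup>2\<close> would be bounded below, and \<open>\<parallel>T x\<parallel>\<close> bounded away from
  \<open>\<parallel>T\<parallel>\<close> on the unit sphere.\<close>

lemma norm_in_spectrum:
  assumes T: "T \<in> A" and sa: "selfadj T"
  shows "\<not> invertible (T - norm T *\<^sub>R e) \<or> \<not> invertible (T + norm T *\<^sub>R e)"
proof (rule ccontr)
  define N where "N = norm T"
  assume "\<not> ?thesis"
  then have inv: "invertible (T - N *\<^sub>R e)" "invertible (T + N *\<^sub>R e)" by (auto simp: N_def)
  define S where "S = (T - N *\<^sub>R e) o\<^sub>L (T + N *\<^sub>R e)"
  have S_eq: "S = (T o\<^sub>L T) - N\<^sup>2 *\<^sub>R e"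
    by (simp add: S_def blinfun_compose.add_right blinfun_compose.diff_left blinfun_compose.scaleR_left
        blinfun_compose.scaleR_right unit_left unit_right T unit_A power2_eq_square algebra_simps)
  have "invertible S" unfolding S_def
    using T unit_A inv by (intro invertible_compose) (auto simp: add_A diff_A scaleR_A)
  then obtain R where R: "R \<in> A" "R o\<^sub>L S = e" unfolding invertible_def by auto
  define \<rho> where "\<rho> = norm R"
  have \<rho>: "\<rho> > 0" using R(2) unit_nonzero unfolding \<rho>_def by auto
  have N0: "N \<noteq> 0"
    using R(2) unit_nonzero S_eq unfolding N_def by auto
  then have N: "N > 0" by (simp add: N_def)
  \<comment> \<open>In the square of \<open>norm (S x)\<close> the cross term is
    \<open>(norm (T x))\<^sup>2\<close> by self-adjointness, and \<open>norm (T (T x))\<close> is at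
    most \<open>N * norm (T x)\<close>. What remains is N^2 times the defect N^2 |e x|^2 - |T
    x|^2.\<close>
  have main: "(norm (e x))\<^sup>2 \<le> \<rho>\<^sup>2 * (N\<^sup>2 * (N\<^sup>2 * (norm (e x))\<^sup>2 - (norm (T x))\<^sup>2))" for x
  proof -
    have "norm (e x) \<le> \<rho> * norm (S x)" unfolding \<rho>_def
      by (metis R(2) blinfun_apply_blinfun_compose norm_blinfun)
    then have 1: "(norm (e x))\<^sup>2 \<le> \<rho>\<^sup>2 * (norm (S x))\<^sup>2"
      by (metis norm_ge_zero power_mono power_mult_distrib)
    have TT: "T (T x) \<bullet> e x = (norm (T x))\<^sup>2"
      by (metis dot_square_norm sa selfadjD unit_apply(2)[OF T])
    have "norm (T (T x)) \<le> N * norm (T x)" unfolding N_def by (rule norm_blinfun)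
    then have 2: "(norm (T (T x)))\<^sup>2 \<le> N\<^sup>2 * (norm (T x))\<^sup>2"
      by (metis norm_ge_zero power_mono power_mult_distrib)
    have "(norm (S x))\<^sup>2 = (norm (T (T x)))\<^sup>2 - 2 * N\<^sup>2 * (norm (T x))\<^sup>2 + N\<^sup>2 * N\<^sup>2 * (norm (e x))\<^sup>2"
      by (simp add: S_eq blinfun.diff_left blinfun.scaleR_left power2_norm_eq_inner inner_diff_left
          inner_diff_right inner_commute[of "e x" "T (T x)"] TT algebra_simps)
    then have "(norm (S x))\<^sup>2 \<le> N\<^sup>2 * (N\<^sup>2 * (norm (e x))\<^sup>2 - (norm (T x))\<^sup>2)"
      using 2 by (simp add: algebra_simps)
    then show ?thesis using 1 \<rho> by (smt (verit) mult_left_mono zero_le_power2)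
  qed
  \<comment> \<open>This is \<open>main\<close> solved for the square of \<open>norm (T x)\<close>.
    As \<open>k\<close> is smaller than N^2, the norm of \<open>T\<close> would be smaller than
    itself.\<close>
  define k where "k = N\<^sup>2 - 1 / (\<rho>\<^sup>2 * N\<^sup>2)"
  have le: "(norm (T x))\<^sup>2 \<le> k * (norm (e x))\<^sup>2" for x
    using main[of x] \<rho> N by (simp add: k_def field_simps)
  obtain x0 where x0: "e x0 \<noteq> 0" using unit_nonzero by (metis blinfun_eqI zero_blinfun.rep_eq)
  have k0: "k \<ge> 0"
  proof (rule ccontr)
    assume "\<not> k \<ge> 0"
    then have "k * (norm (e x0))\<^sup>2 < 0" using x0 by (simp add: mult_neg_pos)
    with le[of x0] show False by (smt (verit) zero_le_power2)
  qed
  have "norm T \<le> sqrt k"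
  proof (rule norm_le_unitI[OF T])
    show "norm (T x) \<le> sqrt k * norm (e x)" for x
      using le[of x] k0 by (simp add: power2_le_imp_le[of _ "sqrt k * norm (e x)"] power_mult_distrib)
  qed (use k0 in simp)
  then have "N\<^sup>2 \<le> k" using k0 N unfolding N_def
    by (metis norm_ge_zero power_mono real_sqrt_pow2)
  moreover have "1 / (\<rho>\<^sup>2 * N\<^sup>2) > 0" using \<rho> N by simp
  ultimately show False by (simp add: k_def)
qed

section \<open>Polynomials of a self-adjoint operator and their spectra\<close>

definition poly_op :: "real poly \<Rightarrow> ('a \<Rightarrow>\<^sub>L 'a) \<Rightarrow> ('a \<Rightarrow>\<^sub>L 'a)" where
  "poly_op p T = fold_coeffs (\<lambda>c S. c *\<^sub>R e + (T o\<^sub>L S)) p 0"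

lemma poly_op_0 [simp]: "poly_op 0 T = 0"
  by (simp add: poly_op_def)

lemma poly_op_pCons [simp]: "poly_op (pCons c p) T = c *\<^sub>R e + (T o\<^sub>L poly_op p T)"
  by (cases "p = 0 \<and> c = 0") (auto simp: poly_op_def)

lemma poly_op_A: "T \<in> A \<Longrightarrow> poly_op p T \<in> A"
  by (induction p) (auto simp: zero_A add_A scaleR_A unit_A compose_A)

lemma poly_op_add: "T \<in> A \<Longrightarrow> poly_op (p + q) T = poly_op p T + poly_op q T"
  by (induction p q rule: poly_induct2)
     (auto simp: blinfun_compose.add_right algebra_simps)

lemma poly_op_smult: "T \<in> A \<Longrightarrow> poly_op (smult c p) T = c *\<^sub>R poly_op p T"
  by (induction p) (auto simp: blinfun_compose.scaleR_right algebra_simps)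

lemma poly_op_diff: "T \<in> A \<Longrightarrow> poly_op (p - q) T = poly_op p T - poly_op q T"
  using poly_op_add[of T p "- q"] poly_op_smult[of T "- 1" q] by simp

lemma poly_op_mult: "T \<in> A \<Longrightarrow> poly_op (p * q) T = poly_op p T o\<^sub>L poly_op q T"
proof (induction p)
  case (pCons c p)
  have "poly_op (pCons c p * q) T = c *\<^sub>R poly_op q T + (T o\<^sub>L (poly_op p T o\<^sub>L poly_op q T))"
    using pCons by (simp add: poly_op_add poly_op_smult)
  then show ?case
    using pCons.prems by (simp add: blinfun_compose.add_left blinfun_compose.scaleR_left unit_left poly_op_A
        blinfun_compose_assoc)
qed simp

lemma poly_op_commute: "T \<in> A \<Longrightarrow> poly_op p T o\<^sub>L T = T o\<^sub>L poly_op p T"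
  using poly_op_mult[of T p "[:0, 1:]"] poly_op_mult[of T "[:0, 1:]" p]
  by (simp add: unit_right mult.commute[of p])

lemma selfadj_poly_op:
  assumes "T \<in> A" "selfadj T"
  shows "selfadj (poly_op p T)"
proof (induction p)
  case 0
  then show ?case by (simp add: selfadj_def)
next
  case (pCons c p)
  then show ?case
    using assms by (simp add: selfadj_add selfadj_scaleR selfadj_unit selfadj_compose poly_op_commute)
qed

text \<open>Horner's scheme in \<open>poly_op\<close> suits induction along \<open>pCons\<close>;
  the explicit sum is the shape of \<open>op_poly\<close> and the form from which traces of powers
  are read off.\<close>

lemma poly_op_eq_sum: "poly_op p T = (\<Sum>i\<le>degree p. coeff p i *\<^sub>R power_op T i)"
proof (induction p)
  case (pCons c p)
  show ?case
  proof (cases "p = 0")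
    case False
    then show ?thesis
      using pCons by (simp add: sum.atMost_Suc_shift blinfun_compose.sum_right
          blinfun_compose.scaleR_right del: sum.atMost_Suc)
  qed simp
qed simp

text \<open>Only real shifts are recorded, because \<open>fun_calc\<close> asks for uniform
  convergence on exactly the real points of \<open>op_spectrum\<close>.\<close>

definition real_spectrum :: "('a \<Rightarrow>\<^sub>L 'a) \<Rightarrow> real set" where
  "real_spectrum T = {t. \<not> invertible (T - t *\<^sub>R e)}"

lemma real_spectrum_nonempty:
  assumes "T \<in> A" "selfadj T"
  shows "real_spectrum T \<noteq> {}"
proof -
  have "norm T \<in> real_spectrum T \<or> - norm T \<in> real_spectrum T"
    using norm_in_spectrum[OF assms] by (simp add: real_spectrum_def)
  then show ?thesis by auto
qed

lemma selfadj_power2_inner: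
  "selfadj T \<Longrightarrow> T (T x) \<bullet> x = (norm (T x))\<^sup>2"
  by (simp add: selfadjD power2_norm_eq_inner)

text \<open>Over the reals \<open>p\<close> splits into linear factors and quadratics without real
  root. A linear factor gives an invertible operator because its root lies off the spectrum;
  completing the square turns a quadratic into the square of a self-adjoint operator plus a positive
  multiple of \<open>e\<close>, which is coercive.\<close>

lemma invertible_poly_op:
  assumes T: "T \<in> A" "selfadj T"
  shows "p \<noteq> 0 \<Longrightarrow> (\<And>t. t \<in> real_spectrum T \<Longrightarrow> poly p t \<noteq> 0) \<Longrightarrow> invertible (poly_op p T)"
proof (induction "degree p" arbitrary: p rule: less_induct)
  case less
  have step: ?case if d: "p = d * q" "degree d > 0" "invertible (poly_op d T)" for d q
  proof -
    have nz: "d \<noteq> 0" "q \<noteq> 0" using less.prems d by auto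
    have "invertible (poly_op q T)"
      using less.prems d nz by (intro less.hyps) (auto simp: degree_mult_eq)
    then show ?thesis using d T by (simp add: poly_op_mult invertible_compose poly_op_A)
  qed
  show ?case
  proof (cases "degree p = 0")
    case True
    then obtain c where c: "p = [:c:]" using degree_eq_zeroE by blast
    then have "c \<noteq> 0" using less.prems by auto
    then show ?thesis using invertible_scaleR[of "inverse c" "c *\<^sub>R e"] invertible_unit by (simp add: c)
  next
    case False
    show ?thesis
    proof (cases "\<exists>t. poly p t = 0")
      case True
      then obtain t where t: "poly p t = 0" by auto
      then obtain q where q: "p = [:- t, 1:] * q" by (auto simp: poly_eq_0_iff_dvd)
      have "t \<notin> real_spectrum T" using less.prems t by auto
      then have "invertible (poly_op [:- t, 1:] T)" using T by (simp add: real_spectrum_def unit_right)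
      then show ?thesis using step[OF q] by simp
    next
      case False
      have "degree (map_poly complex_of_real p) = degree p" by (simp add: degree_map_poly)
      then have "\<not> constant (poly (map_poly complex_of_real p))"
        using \<open>degree p \<noteq> 0\<close> by (simp add: constant_degree)
      then obtain z where z: "poly (map_poly complex_of_real p) z = 0"
        using fundamental_theorem_of_algebra by blast
      have im: "Im z \<noteq> 0"
      proof
        assume "Im z = 0"
        then have "z = of_real (Re z)" by (simp add: complex_eq_iff)
        then have "poly (map_poly complex_of_real p) z = of_real (poly p (Re z))"
          by (metis poly_map_poly_of_real)
        then show False using z False by simp
      qed
      define d where "d = [:(Re z)\<^sup>2 + (Im z)\<^sup>2, - 2 * Re z, 1:]"
      obtain q where q: "p = d * q" using quadratic_dvd[OF z im] unfolding d_def by auto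
      define S where "S = T - Re z *\<^sub>R e"
      have S: "S \<in> A" "selfadj S"
        using T
        by (auto simp: S_def diff_A scaleR_A unit_A selfadj_diff selfadj_scaleR selfadj_unit)
      have "d = [:- Re z, 1:] * [:- Re z, 1:] + [:(Im z)\<^sup>2:]"
        by (simp add: d_def power2_eq_square)
      then have pd: "poly_op d T = (S o\<^sub>L S) + (Im z)\<^sup>2 *\<^sub>R e"
        using T by (simp only: poly_op_add poly_op_mult) (simp add: S_def unit_right)
      have "invertible (poly_op d T)"
      proof (rule invertible_coercive)
        show "poly_op d T \<in> A" by (simp add: poly_op_A T)
        show "(Im z)\<^sup>2 > 0" using im by simp
        show "(Im z)\<^sup>2 * (norm (e x))\<^sup>2 \<le> poly_op d T x \<bullet> x" for x
          using S inner_unit[OF unit_A, of x]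
          by (simp add: pd blinfun.add_left blinfun.scaleR_left inner_add_left selfadj_power2_inner
              power2_norm_eq_inner[of "e x"])
      qed
      then show ?thesis using step[OF q] by (simp add: d_def)
    qed
  qed
qed

text \<open>The spectral mapping theorem reduces the bound to the fact that plus or minus the norm of
  \<open>p(T)\<close> lies in its spectrum.\<close>

lemma norm_poly_op_le:
  assumes T: "T \<in> A" "selfadj T" and K: "\<And>t. t \<in> real_spectrum T \<Longrightarrow> \<bar>poly p t\<bar> \<le> \<delta>"
  shows "norm (poly_op p T) \<le> \<delta>"
proof -
  have "\<exists>s \<in> real_spectrum (poly_op p T). \<bar>s\<bar> = norm (poly_op p T)"
    using norm_in_spectrum[OF poly_op_A selfadj_poly_op, OF T(1) T, of p]
    unfolding real_spectrum_def by (force intro: exI[of _ "- norm (poly_op p T)"])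
  then obtain s where s: "s \<in> real_spectrum (poly_op p T)" "\<bar>s\<bar> = norm (poly_op p T)" by blast
  have "\<exists>t \<in> real_spectrum T. poly p t = s"
  proof (rule ccontr)
    assume none: "\<not> ?thesis"
    \<comment> \<open>\<open>invertible_poly_op\<close> excludes the zero polynomial. A point of the
      spectrum shows that \<open>p\<close> is not the constant \<open>s\<close>.\<close>
    obtain t0 where "t0 \<in> real_spectrum T" using real_spectrum_nonempty T by blast
    then have "p - [:s:] \<noteq> 0" using none by force
    then have "invertible (poly_op (p - [:s:]) T)" using none T by (intro invertible_poly_op) auto
    then show False using s T by (simp add: real_spectrum_def poly_op_diff)
  qed
  then show ?thesis using K s(2) by metis
qed

text \<open>For \<open>t\<close> below \<open>a\<close> the operator
  \<open>T - t *\<^sub>R e\<close> is coercive, and for \<open>t\<close> above \<open>b\<close> its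
  negative is.\<close>

lemma real_spectrum_subset_Icc:
  assumes T: "T \<in> A" "selfadj T"
    and a: "\<And>x. a * (norm (e x))\<^sup>2 \<le> T x \<bullet> x" and b: "\<And>x. T x \<bullet> x \<le> b * (norm (e x))\<^sup>2"
  shows "real_spectrum T \<subseteq> {a..b}"
proof -
  have ee: "(norm (e x))\<^sup>2 = e x \<bullet> x" for x
    using inner_unit[OF unit_A, of x] by (simp add: power2_norm_eq_inner)
  have "t \<notin> real_spectrum T" if "t < a" for t
  proof -
    have "invertible (T - t *\<^sub>R e)"
      using a that T unit_A
      by (intro invertible_coercive[of _ "a - t"])
         (auto simp: diff_A scaleR_A blinfun.diff_left blinfun.scaleR_left inner_diff_left ee algebra_simps)
    then show ?thesis by (simp add: real_spectrum_def)
  qed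
  moreover have "t \<notin> real_spectrum T" if "t > b" for t
  proof -
    have "invertible (t *\<^sub>R e - T)"
      using b that T unit_A
      by (intro invertible_coercive[of _ "t - b"])
         (auto simp: diff_A scaleR_A blinfun.diff_left blinfun.scaleR_left inner_diff_left ee algebra_simps)
    then show ?thesis using invertible_scaleR[of "-1" "T - t *\<^sub>R e"] by (simp add: real_spectrum_def)
  qed
  ultimately show ?thesis by (meson atLeastAtMost_iff not_le subsetI)
qed

end

subsection \<open>Continuous functional calculus\<close>

context op_algebra begin

text \<open>\<open>calculus H I u B\<close> stands for \<open>B = u(H)\<close>; it is meaningful only if \<open>I\<close> contains the real
  spectrum of \<open>H\<close>.\<close>

definition calculus :: "('a \<Rightarrow>\<^sub>L 'a) \<Rightarrow> real set \<Rightarrow> (real \<Rightarrow> real) \<Rightarrow> ('a \<Rightarrow>\<^sub>L 'a) \<Rightarrow> bool" where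
  "calculus H I u B \<longleftrightarrow> (\<exists>p :: nat \<Rightarrow> real poly.
     uniform_limit I (\<lambda>n. poly (p n)) u sequentially \<and> (\<lambda>n. poly_op (p n) H) \<longlonglongrightarrow> B)"

lemma calculus_cong: "calculus H I u B \<Longrightarrow> (\<And>t. t \<in> I \<Longrightarrow> u t = v t) \<Longrightarrow> calculus H I v B"
  unfolding calculus_def
  by (rule ex_forward, assumption) (auto intro: iffD1[OF uniform_limit_cong'[OF refl]])

lemma calculus_subset: "calculus H I u B \<Longrightarrow> J \<subseteq> I \<Longrightarrow> calculus H J u B"
  unfolding calculus_def using uniform_limit_on_subset by blast

lemma calculus_continuous: "calculus H I u B \<Longrightarrow> continuous_on I u"
  unfolding calculus_def
  by (elim exE conjE, rule uniform_limit_theorem) (auto intro!: always_eventually continuous_intros)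

context
  fixes H I
  assumes H: "H \<in> A" "selfadj H" "real_spectrum H \<subseteq> I"
begin

text \<open>The bound of \<open>norm_poly_op_le\<close> passes to limits. With \<delta> = 0 it makes
  \<open>u(H)\<close> unique; later it yields the Lipschitz bound for traces.\<close>

lemma calculus_norm_diff:
  assumes "calculus H I u B" "calculus H I v C" "\<And>t. t \<in> I \<Longrightarrow> \<bar>u t - v t\<bar> \<le> \<delta>"
  shows "norm (B - C) \<le> \<delta>"
proof (rule field_le_epsilon)
  fix \<epsilon> :: real assume \<epsilon>: "\<epsilon> > 0"
  obtain p q where p: "uniform_limit I (\<lambda>n. poly (p n)) u sequentially" "(\<lambda>n. poly_op (p n) H) \<longlonglongrightarrow> B"
    and q: "uniform_limit I (\<lambda>n. poly (q n)) v sequentially" "(\<lambda>n. poly_op (q n) H) \<longlonglongrightarrow> C"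
    using assms unfolding calculus_def by blast
  have "\<forall>\<^sub>F n in sequentially. norm (poly_op (p n) H - poly_op (q n) H) \<le> \<delta> + \<epsilon>"
    using uniform_limitD[OF p(1) half_gt_zero[OF \<epsilon>]] uniform_limitD[OF q(1) half_gt_zero[OF \<epsilon>]]
  proof eventually_elim
    case (elim n)
    have "\<bar>poly (p n - q n) t\<bar> \<le> \<delta> + \<epsilon>" if "t \<in> real_spectrum H" for t
    proof -
      have "t \<in> I" using that H by auto
      then have "\<bar>poly (p n) t - u t\<bar> < \<epsilon> / 2" "\<bar>poly (q n) t - v t\<bar> < \<epsilon> / 2" "\<bar>u t - v t\<bar> \<le> \<delta>"
        using elim assms(3) by (auto simp: dist_real_def)
      then show ?thesis unfolding poly_diff by linarith
    qed
    then show ?case using norm_poly_op_le[OF H(1,2), of "p n - q n"] by (simp add: poly_op_diff H)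
  qed
  moreover have "(\<lambda>n. norm (poly_op (p n) H - poly_op (q n) H)) \<longlonglongrightarrow> norm (B - C)"
    by (intro tendsto_intros p q)
  ultimately show "norm (B - C) \<le> \<delta> + \<epsilon>"
    by (intro tendsto_upperbound) auto
qed

lemma calculus_unique: "calculus H I u B \<Longrightarrow> calculus H I u C \<Longrightarrow> B = C"
  using calculus_norm_diff[of u B u C 0] by simp

lemma calculus_A: "calculus H I u B \<Longrightarrow> B \<in> A"
  using closed_sequentially[OF closed_A] poly_op_A[OF H(1)] by (fastforce simp: calculus_def)

lemma calculus_selfadj: "calculus H I u B \<Longrightarrow> selfadj B"
  using closed_sequentially[OF closed_selfadj] selfadj_poly_op[OF H(1,2)] by (fastforce simp: calculus_def)

lemma calculus_const: "calculus H I (\<lambda>_. c) (c *\<^sub>R e)"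
  unfolding calculus_def by (rule exI[of _ "\<lambda>_. [:c:]"]) (simp add: poly_fun uniform_limit_const)

lemma calculus_id: "calculus H I (\<lambda>t. t) H"
  unfolding calculus_def
  by (rule exI[of _ "\<lambda>_. [:0, 1:]"]) (simp add: poly_fun uniform_limit_const unit_right H)

lemma calculus_add: "calculus H I u B \<Longrightarrow> calculus H I v C \<Longrightarrow> calculus H I (\<lambda>t. u t + v t) (B + C)"
  unfolding calculus_def
proof (elim exE conjE)
  fix p q assume *: "uniform_limit I (\<lambda>n. poly (p n)) u sequentially" "(\<lambda>n. poly_op (p n) H) \<longlonglongrightarrow> B"
    "uniform_limit I (\<lambda>n. poly (q n)) v sequentially" "(\<lambda>n. poly_op (q n) H) \<longlonglongrightarrow> C"
  show "\<exists>p. uniform_limit I (\<lambda>n. poly (p n)) (\<lambda>t. u t + v t) sequentially \<and> (\<lambda>n. poly_op (p n) H) \<longlonglongrightarrow> B + C"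
    using uniform_limit_add[OF *(1,3)] tendsto_add[OF *(2,4)]
    by (intro exI[of _ "\<lambda>n. p n + q n"]) (simp add: poly_fun poly_op_add H)
qed

context
  assumes compact_I: "compact I"
begin

lemma calculus_exists:
  assumes "continuous_on I u"
  shows "\<exists>B. calculus H I u B"
proof -
  obtain p where p: "\<And>n t. t \<in> I \<Longrightarrow> \<bar>u t - poly (p n) t\<bar> < inverse (Suc n)"
    "uniform_limit I (\<lambda>n. poly (p n)) u sequentially"
    using uniform_poly_approximation[OF compact_I assms] by metis
  have "Cauchy (\<lambda>n. poly_op (p n) H)"
  proof (rule CauchyI)
    fix \<epsilon> :: real assume "\<epsilon> > 0"
    then obtain N where N: "\<And>n. n \<ge> N \<Longrightarrow> inverse (real (Suc n)) < \<epsilon> / 3"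
      using order_tendstoD(2)[OF LIMSEQ_inverse_real_of_nat, of "\<epsilon> / 3"]
      by (auto simp: eventually_sequentially)
    show "\<exists>M. \<forall>m\<ge>M. \<forall>n\<ge>M. norm (poly_op (p m) H - poly_op (p n) H) < \<epsilon>"
    proof (intro exI allI impI)
      fix m n assume mn: "m \<ge> N" "n \<ge> N"
      have "norm (poly_op (p m - p n) H) \<le> 2 * \<epsilon> / 3"
      proof (rule norm_poly_op_le[OF H(1,2)])
        fix t assume "t \<in> real_spectrum H"
        then have "t \<in> I" using H by auto
        then show "\<bar>poly (p m - p n) t\<bar> \<le> 2 * \<epsilon> / 3"
          using p(1)[of t m] p(1)[of t n] N[OF mn(1)] N[OF mn(2)] unfolding poly_diff by linarith
      qed
      then show "norm (poly_op (p m) H - poly_op (p n) H) < \<epsilon>"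
        using \<open>\<epsilon> > 0\<close> by (simp add: poly_op_diff H)
    qed
  qed
  then obtain B where "(\<lambda>n. poly_op (p n) H) \<longlonglongrightarrow> B" using Cauchy_convergent convergent_def by blast
  then show ?thesis using p(2) unfolding calculus_def by blast
qed

text \<open>Compactness of \<open>I\<close> enters through boundedness of \<open>u\<close> and
  \<open>v\<close>, which makes the products of the approximating polynomials converge
  uniformly.\<close>

lemma calculus_mult:
  assumes u: "calculus H I u B" and v: "calculus H I v C"
  shows "calculus H I (\<lambda>t. u t * v t) (B o\<^sub>L C)"
proof -
  obtain p q where p: "uniform_limit I (\<lambda>n. poly (p n)) u sequentially" "(\<lambda>n. poly_op (p n) H) \<longlonglongrightarrow> B"
    and q: "uniform_limit I (\<lambda>n. poly (q n)) v sequentially" "(\<lambda>n. poly_op (q n) H) \<longlonglongrightarrow> C"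
    using assms unfolding calculus_def by blast
  have "bounded (u ` I)" "bounded (v ` I)"
    using u v calculus_continuous compact_I compact_continuous_image compact_imp_bounded by blast+
  then have "uniform_limit I (\<lambda>n. poly (p n * q n)) (\<lambda>t. u t * v t) sequentially"
    using bounded_bilinear.bounded_uniform_limit[OF bounded_bilinear_mult p(1) q(1)] by (simp add: poly_fun)
  moreover have "(\<lambda>n. poly_op (p n * q n) H) \<longlonglongrightarrow> (B o\<^sub>L C)"
    using blinfun_compose.tendsto[OF p(2) q(2)] by (simp add: poly_op_mult H)
  ultimately show ?thesis unfolding calculus_def by (intro exI[of _ "\<lambda>n. p n * q n"] conjI)
qed

lemma calculus_poly_op: "calculus H I u B \<Longrightarrow> calculus H I (\<lambda>t. poly q (u t)) (poly_op q B)"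
proof (induction q)
  case 0
  then show ?case using calculus_const[of 0] by simp
next
  case (pCons c q)
  then show ?case using calculus_add[OF calculus_const calculus_mult, of u B _ _ c] by simp
qed

text \<open>If \<open>s\<close> is not a value of \<open>u\<close> on \<open>I\<close>, then 1/(u -
  s) is continuous there, and applying it to \<open>H\<close> produces the inverse of
  \<open>B - s *\<^sub>R e\<close>.\<close>

lemma real_spectrum_calculus:
  assumes u: "calculus H I u B"
  shows "real_spectrum B \<subseteq> u ` I"
proof
  fix s assume s: "s \<in> real_spectrum B"
  show "s \<in> u ` I"
  proof (rule ccontr)
    assume n: "s \<notin> u ` I"
    then have nz: "u t - s \<noteq> 0" if "t \<in> I" for t using that by auto
    then have "continuous_on I (\<lambda>t. inverse (u t - s))"
      by (intro continuous_intros calculus_continuous[OF u]) auto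
    then obtain C where C: "calculus H I (\<lambda>t. inverse (u t - s)) C" using calculus_exists by blast
    have B: "calculus H I (\<lambda>t. u t - s) (B - s *\<^sub>R e)"
      using calculus_add[OF u calculus_const[of "- s"]] by simp
    have one: "calculus H I (\<lambda>_. 1) e" using calculus_const[of 1] by simp
    have "calculus H I (\<lambda>_. 1) ((B - s *\<^sub>R e) o\<^sub>L C)" "calculus H I (\<lambda>_. 1) (C o\<^sub>L (B - s *\<^sub>R e))"
      using nz by (auto intro!: calculus_cong[OF calculus_mult[OF B C]] calculus_cong[OF calculus_mult[OF C B]])
    then have "(B - s *\<^sub>R e) o\<^sub>L C = e" "C o\<^sub>L (B - s *\<^sub>R e) = e"
      using calculus_unique one by blast+
    then show False using s calculus_A[OF C] by (auto simp: real_spectrum_def invertible_def)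
  qed
qed

text \<open>For polynomials \<open>p n\<close> tending to \<open>v\<close>,
  \<open>calculus_poly_op\<close> identifies \<open>poly_op (p n) B\<close> as a function of
  \<open>H\<close>, so its distance to \<open>C\<close> is estimated on \<open>I\<close> without
  leaving the calculus of \<open>H\<close>.\<close>

lemma calculus_compose:
  assumes u: "calculus H I u B" and v: "continuous_on (u ` I) v" and C: "calculus H I (\<lambda>t. v (u t)) C"
  shows "calculus B (u ` I) v C"
proof -
  have "compact (u ` I)" using calculus_continuous[OF u] compact_I compact_continuous_image by blast
  then obtain p where p: "\<And>n t. t \<in> u ` I \<Longrightarrow> \<bar>v t - poly (p n) t\<bar> < inverse (Suc n)"
    "uniform_limit (u ` I) (\<lambda>n. poly (p n)) v sequentially"
    using uniform_poly_approximation[OF _ v] by metis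
  have "norm (poly_op (p n) B - C) \<le> inverse (real (Suc n))" for n
  proof (rule calculus_norm_diff[OF calculus_poly_op[OF u] C])
    fix t assume "t \<in> I"
    then show "\<bar>poly (p n) (u t) - v (u t)\<bar> \<le> inverse (real (Suc n))"
      using p(1)[of "u t" n] by (simp add: abs_minus_commute)
  qed
  then have "(\<lambda>n. poly_op (p n) B - C) \<longlonglongrightarrow> 0"
    using LIMSEQ_inverse_real_of_nat by (intro Lim_null_comparison[OF _ LIMSEQ_inverse_real_of_nat]) auto
  then show ?thesis using p(2) unfolding calculus_def by (auto simp: LIM_zero_iff)
qed

end
end

end

subsection \<open>Square-summable functions\<close>

text \<open>The locale \<open>op_algebra\<close> works over a type of classes
  \<open>real_inner\<close> and \<open>banach\<close>, hence functions on a whole type with real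
  scalars; complex scalars return as the operators \<open>scale_op c\<close>.\<close>

typedef 'a ell2 = "{x :: 'a \<Rightarrow> complex. (\<lambda>g. (norm (x g))\<^sup>2) summable_on UNIV}"
  morphisms coeff2 Abs_ell2
  by (rule exI[of _ "\<lambda>_. 0"]) simp

setup_lifting type_definition_ell2

lemma coeff2_summable: "(\<lambda>g. (norm (coeff2 x g))\<^sup>2) summable_on UNIV"
  using coeff2[of x] by simp

lemma ell2_eqI: "(\<And>g. coeff2 x g = coeff2 y g) \<Longrightarrow> x = y"
  by (simp add: coeff2_inject[symmetric] fun_eq_iff)

lemma summable_on_norm_add_squared:
  assumes "(\<lambda>g. (norm (x g))\<^sup>2) summable_on S" "(\<lambda>g. (norm (y g))\<^sup>2) summable_on S"
  shows "(\<lambda>g. (norm (x g + y g :: complex))\<^sup>2) summable_on S"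
proof (rule summable_on_comparison_test)
  show "(\<lambda>g. 2 * (norm (x g))\<^sup>2 + 2 * (norm (y g))\<^sup>2) summable_on S"
    by (intro summable_on_add summable_on_cmult_right assms)
  show "(norm (x g + y g))\<^sup>2 \<le> 2 * (norm (x g))\<^sup>2 + 2 * (norm (y g))\<^sup>2" for g
  proof -
    have "(norm (x g + y g))\<^sup>2 \<le> (norm (x g) + norm (y g))\<^sup>2"
      by (intro power_mono norm_triangle_ineq norm_ge_zero)
    also have "\<dots> \<le> 2 * (norm (x g))\<^sup>2 + 2 * (norm (y g))\<^sup>2"
      using sum_squares_bound[of "norm (x g)" "norm (y g)"] by (simp add: power2_sum)
    finally show ?thesis .
  qed
qed simp

lemma summable_on_norm_cmult_squared:
  assumes "(\<lambda>g. (norm (x g))\<^sup>2) summable_on S"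
  shows "(\<lambda>g. (norm (c * x g :: complex))\<^sup>2) summable_on S"
  using summable_on_cmult_right[OF assms, of "(norm c)\<^sup>2"] by (simp add: norm_mult power_mult_distrib)

instantiation ell2 :: (type) real_vector
begin

lift_definition zero_ell2 :: "'a ell2" is "\<lambda>_. 0" by simp
lift_definition plus_ell2 :: "'a ell2 \<Rightarrow> 'a ell2 \<Rightarrow> 'a ell2" is "\<lambda>x y g. x g + y g"
  by (rule summable_on_norm_add_squared)
lift_definition uminus_ell2 :: "'a ell2 \<Rightarrow> 'a ell2" is "\<lambda>x g. - x g" by simp
lift_definition minus_ell2 :: "'a ell2 \<Rightarrow> 'a ell2 \<Rightarrow> 'a ell2" is "\<lambda>x y g. x g - y g"
  using summable_on_norm_add_squared[of _ UNIV "\<lambda>g. - _ g"] by simp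
lift_definition scaleR_ell2 :: "real \<Rightarrow> 'a ell2 \<Rightarrow> 'a ell2" is "\<lambda>c x g. c *\<^sub>R x g"
  using summable_on_norm_cmult_squared by (simp add: scaleR_conv_of_real)

instance
  by intro_classes (transfer; simp add: fun_eq_iff algebra_simps scaleR_conv_of_real)+

end

lemma coeff2_simps [simp]:
  "coeff2 0 g = 0" "coeff2 (x + y) g = coeff2 x g + coeff2 y g" "coeff2 (- x) g = - coeff2 x g"
  "coeff2 (x - y) g = coeff2 x g - coeff2 y g" "coeff2 (r *\<^sub>R x) g = r *\<^sub>R coeff2 x g"
  by (simp_all add: zero_ell2.rep_eq plus_ell2.rep_eq uminus_ell2.rep_eq minus_ell2.rep_eq
      scaleR_ell2.rep_eq)

lemma inner_summable:
  fixes x y :: "'a \<Rightarrow> complex"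
  assumes "(\<lambda>g. (norm (x g))\<^sup>2) summable_on S" "(\<lambda>g. (norm (y g))\<^sup>2) summable_on S"
  shows "(\<lambda>g. norm (x g) * norm (y g)) summable_on S"
proof (rule summable_on_comparison_test)
  show "(\<lambda>g. (norm (x g))\<^sup>2 + (norm (y g))\<^sup>2) summable_on S"
    by (intro summable_on_add assms)
  show "norm (x g) * norm (y g) \<le> (norm (x g))\<^sup>2 + (norm (y g))\<^sup>2" for g
    using sum_squares_bound[of "norm (x g)" "norm (y g)"]
      mult_nonneg_nonneg[OF norm_ge_zero[of "x g"] norm_ge_zero[of "y g"]] by linarith
qed simp

lemma coeff2_inner_summable: "(\<lambda>g. coeff2 x g \<bullet> coeff2 y g) summable_on UNIV"
proof (rule abs_summable_summable)
  show "(\<lambda>g. norm (coeff2 x g \<bullet> coeff2 y g)) summable_on UNIV"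
    by (rule summable_on_comparison_test[OF inner_summable[OF coeff2_summable[of x] coeff2_summable[of y]]])
       (auto simp: Cauchy_Schwarz_ineq2)
qed

instantiation ell2 :: (type) real_inner
begin

text \<open>The dot of two complex numbers is the real part of one times the conjugate of the other,
  so this is the real part of the Hermitian inner product and induces the same norm.\<close>

definition inner_ell2 :: "'a ell2 \<Rightarrow> 'a ell2 \<Rightarrow> real" where
  "inner_ell2 x y = (\<Sum>\<^sub>\<infinity>g. coeff2 x g \<bullet> coeff2 y g)"
definition norm_ell2 :: "'a ell2 \<Rightarrow> real" where "norm_ell2 x = sqrt (x \<bullet> x)"
definition dist_ell2 :: "'a ell2 \<Rightarrow> 'a ell2 \<Rightarrow> real" where "dist_ell2 x y = norm (x - y)"
definition sgn_ell2 :: "'a ell2 \<Rightarrow> 'a ell2" where "sgn_ell2 x = x /\<^sub>R norm x"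
definition uniformity_ell2 :: "('a ell2 \<times> 'a ell2) filter" where
  "uniformity_ell2 = (INF e\<in>{0 <..}. principal {(x, y). dist x y < e})"
definition open_ell2 :: "'a ell2 set \<Rightarrow> bool" where
  "open_ell2 U \<longleftrightarrow> (\<forall>x\<in>U. eventually (\<lambda>(x', y). x' = x \<longrightarrow> y \<in> U) uniformity)"

instance
proof
  fix x y z :: "'a ell2" and r :: real and U :: "'a ell2 set"
  show "dist x y = norm (x - y)" "sgn x = x /\<^sub>R norm x" "norm x = sqrt (x \<bullet> x)"
    "uniformity = (INF e\<in>{0 <..}. principal {(x :: 'a ell2, y). dist x y < e})"
    "open U \<longleftrightarrow> (\<forall>x\<in>U. eventually (\<lambda>(x', y). x' = x \<longrightarrow> y \<in> U) uniformity)"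
    by (rule dist_ell2_def sgn_ell2_def norm_ell2_def uniformity_ell2_def open_ell2_def)+
  show "x \<bullet> y = y \<bullet> x" by (simp add: inner_ell2_def inner_commute)
  show "(x + y) \<bullet> z = x \<bullet> z + y \<bullet> z"
    by (simp add: inner_ell2_def inner_add_left infsum_add coeff2_inner_summable)
  show "(r *\<^sub>R x) \<bullet> y = r * (x \<bullet> y)"
    by (simp add: inner_ell2_def infsum_cmult_right')
  show "0 \<le> x \<bullet> x" by (simp add: inner_ell2_def infsum_nonneg)
  show "(x \<bullet> x = 0) = (x = 0)"
  proof
    assume "x \<bullet> x = 0"
    then have "coeff2 x g \<bullet> coeff2 x g = 0" for g
      using nonneg_infsum_le_0D[of "\<lambda>g. coeff2 x g \<bullet> coeff2 x g" UNIV g] coeff2_inner_summable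
      by (auto simp: inner_ell2_def)
    then show "x = 0" by (auto intro!: ell2_eqI)
  qed (simp add: inner_ell2_def)
qed

end

lemma norm_ell2_squared: "(norm x)\<^sup>2 = (\<Sum>\<^sub>\<infinity>g. (norm (coeff2 x g))\<^sup>2)"
  by (simp add: power2_norm_eq_inner) (simp add: inner_ell2_def power2_norm_eq_inner)

lemma sum_coeff2_le: "finite F \<Longrightarrow> (\<Sum>g\<in>F. (norm (coeff2 x g))\<^sup>2) \<le> (norm x)\<^sup>2"
  unfolding norm_ell2_squared by (intro finite_sum_le_infsum coeff2_summable) auto

lemma norm_coeff2_le: "norm (coeff2 x g) \<le> norm x"
  by (rule power2_le_imp_le) (use sum_coeff2_le[of "{g}" x] in auto)

lemma norm_ell2_le:
  assumes "0 \<le> b" "\<And>F. finite F \<Longrightarrow> (\<Sum>g\<in>F. (norm (coeff2 x g))\<^sup>2) \<le> b\<^sup>2"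
  shows "norm x \<le> b"
proof (rule power2_le_imp_le)
  show "(norm x)\<^sup>2 \<le> b\<^sup>2"
    unfolding norm_ell2_squared by (intro infsum_le_finite_sums coeff2_summable assms)
qed (fact assms)

lemma bounded_linear_coeff2: "bounded_linear (\<lambda>x. coeff2 x g)"
  by (rule bounded_linear_intro[of _ 1]) (auto simp: norm_coeff2_le)

instance ell2 :: (type) banach
proof
  fix X :: "nat \<Rightarrow> 'a ell2"
  assume X: "Cauchy X"
  have "Cauchy (\<lambda>n. coeff2 (X n) g)" for g
    using bounded_linear.Cauchy[OF bounded_linear_coeff2 X] .
  then have "convergent (\<lambda>n. coeff2 (X n) g)" for g by (rule Cauchy_convergent)
  moreover define l where "l g = lim (\<lambda>n. coeff2 (X n) g)" for g
  ultimately have l: "(\<lambda>n. coeff2 (X n) g) \<longlonglongrightarrow> l g" for g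
    by (simp add: convergent_LIMSEQ_iff)
  \<comment> \<open>Finite sums pass to the coordinatewise limit. The bound is uniform in
    \<open>F\<close>, so it yields both that \<open>X m\<close> minus the limit is square-summable
    and that its norm is small.\<close>
  have fin: "(\<Sum>g\<in>F. (norm (coeff2 (X m) g - l g))\<^sup>2) \<le> \<epsilon>\<^sup>2"
    if F: "finite F" and N: "\<And>n. n \<ge> N \<Longrightarrow> norm (X m - X n) \<le> \<epsilon>" for F m N \<epsilon>
  proof (rule tendsto_upperbound)
    show "(\<lambda>n. \<Sum>g\<in>F. (norm (coeff2 (X m) g - coeff2 (X n) g))\<^sup>2) \<longlonglongrightarrow> (\<Sum>g\<in>F. (norm (coeff2 (X m) g - l g))\<^sup>2)"
      by (intro tendsto_intros l)
    show "\<forall>\<^sub>F n in sequentially. (\<Sum>g\<in>F. (norm (coeff2 (X m) g - coeff2 (X n) g))\<^sup>2) \<le> \<epsilon>\<^sup>2"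
      using eventually_ge_at_top[of N]
    proof eventually_elim
      case (elim n)
      have "(\<Sum>g\<in>F. (norm (coeff2 (X m - X n) g))\<^sup>2) \<le> (norm (X m - X n))\<^sup>2"
        by (rule sum_coeff2_le[OF F])
      also have "\<dots> \<le> \<epsilon>\<^sup>2" using N[OF elim] by (intro power_mono) auto
      finally show ?case by simp
    qed
  qed simp
  obtain N1 where "\<And>m n. m \<ge> N1 \<Longrightarrow> n \<ge> N1 \<Longrightarrow> norm (X m - X n) < 1"
    using CauchyD[OF X, of 1] by auto
  then have N1: "\<And>n. n \<ge> N1 \<Longrightarrow> norm (X N1 - X n) \<le> 1" by (metis less_imp_le order_refl)
  have "(\<lambda>g. (norm (coeff2 (X N1) g - l g))\<^sup>2) summable_on UNIV"
    by (rule nonneg_bdd_above_summable_on) (auto intro!: bdd_aboveI[of _ "1\<^sup>2"] fin[OF _ N1])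
  \<comment> \<open>The limit is recovered as \<open>X N1\<close> plus -1 times the difference just
    shown to be square-summable.\<close>
  then have "(\<lambda>g. (norm (- 1 * (coeff2 (X N1) g - l g)))\<^sup>2) summable_on UNIV"
    by (rule summable_on_norm_cmult_squared)
  from summable_on_norm_add_squared[OF coeff2_summable[of "X N1"] this]
  have "(\<lambda>g. (norm (l g))\<^sup>2) summable_on UNIV" by simp
  then have L: "coeff2 (Abs_ell2 l) = l" by (simp add: Abs_ell2_inverse)
  have "X \<longlonglongrightarrow> Abs_ell2 l"
  proof (rule LIMSEQ_I)
    fix \<epsilon> :: real assume \<epsilon>: "\<epsilon> > 0"
    then obtain N where N: "\<And>m n. m \<ge> N \<Longrightarrow> n \<ge> N \<Longrightarrow> norm (X m - X n) < \<epsilon> / 2"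
      using CauchyD[OF X, of "\<epsilon> / 2"] by auto
    have "norm (X m - Abs_ell2 l) \<le> \<epsilon> / 2" if "m \<ge> N" for m
    proof (rule norm_ell2_le)
      fix F :: "'a set" assume "finite F"
      then show "(\<Sum>g\<in>F. (norm (coeff2 (X m - Abs_ell2 l) g))\<^sup>2) \<le> (\<epsilon> / 2)\<^sup>2"
        using fin[of F N m "\<epsilon> / 2"] N[OF that] by (auto simp: L less_imp_le)
    qed (use \<epsilon> in auto)
    then show "\<exists>no. \<forall>n\<ge>no. norm (X n - Abs_ell2 l) < \<epsilon>"
      using \<epsilon> by (intro exI[of _ N]) force
  qed
  then show "convergent X" by (auto simp: convergent_def)
qed

section \<open>Complex scalars and composition operators on \<open>ell2\<close>\<close>

lift_definition mult_fun :: "complex \<Rightarrow> 'a ell2 \<Rightarrow> 'a ell2" is "\<lambda>c x g. c * x g"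
  by (rule summable_on_norm_cmult_squared)

lemma norm_mult_fun: "norm (mult_fun c x) = norm c * norm x"
  by (rule power2_eq_imp_eq)
     (simp_all add: norm_ell2_squared power_mult_distrib norm_mult mult_fun.rep_eq infsum_cmult_right')

lemma bounded_linear_mult_fun: "bounded_linear (mult_fun c)"
  by (rule bounded_linear_intro[of _ "norm c"])
     (auto intro!: ell2_eqI simp: mult_fun.rep_eq norm_mult_fun algebra_simps)

lift_definition scale_op :: "complex \<Rightarrow> 'a ell2 \<Rightarrow>\<^sub>L 'a ell2" is mult_fun
  by (rule bounded_linear_mult_fun)

lemma coeff2_scale_op [simp]: "coeff2 (scale_op c x) g = c * coeff2 x g"
  by (simp add: scale_op.rep_eq mult_fun.rep_eq)

lemma norm_scale_op: "norm (scale_op c) \<le> norm c"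
  by (rule norm_blinfun_bound) (simp_all add: scale_op.rep_eq norm_mult_fun)

text \<open>The composition operator is meaningful only for \<open>\<sigma>\<close> injective on \<open>S\<close>.\<close>

definition comp_op :: "'a set \<Rightarrow> ('a \<Rightarrow> 'a) \<Rightarrow> 'a ell2 \<Rightarrow>\<^sub>L 'a ell2" where
  "comp_op S \<sigma> = Blinfun (\<lambda>x. Abs_ell2 (\<lambda>g. if g \<in> S then coeff2 x (\<sigma> g) else 0))"

context
  fixes S :: "'a set" and \<sigma> :: "'a \<Rightarrow> 'a"
  assumes inj: "inj_on \<sigma> S"
begin

lemma comp_op_summable:
  "(\<lambda>g. (norm (if g \<in> S then coeff2 x (\<sigma> g) else 0))\<^sup>2) summable_on UNIV"
proof -
  have "(\<lambda>g. (norm (coeff2 x g))\<^sup>2) summable_on \<sigma> ` S"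
    using coeff2_summable by (rule summable_on_subset_banach) auto
  then have "(\<lambda>g. (norm (coeff2 x (\<sigma> g)))\<^sup>2) summable_on S"
    using summable_on_reindex[OF inj, of "\<lambda>g. (norm (coeff2 x g))\<^sup>2"] by (simp add: o_def)
  then show ?thesis
    by (rule iffD1[OF summable_on_cong_neutral, rotated -1]) auto
qed

lemma coeff2_comp_op:
  "coeff2 (comp_op S \<sigma> x) g = (if g \<in> S then coeff2 x (\<sigma> g) else 0)"
  and norm_comp_op: "norm (comp_op S \<sigma>) \<le> 1"
proof -
  define f :: "'a ell2 \<Rightarrow> 'a ell2" where "f x = Abs_ell2 (\<lambda>g. if g \<in> S then coeff2 x (\<sigma> g) else 0)" for x
  have f: "coeff2 (f x) g = (if g \<in> S then coeff2 x (\<sigma> g) else 0)" for x g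
    using comp_op_summable by (simp add: f_def Abs_ell2_inverse)
  have n: "norm (f x) \<le> norm x" for x
  proof (rule norm_ell2_le)
    fix F :: "'a set" assume F: "finite F"
    have "(\<Sum>g\<in>F. (norm (coeff2 (f x) g))\<^sup>2) = (\<Sum>g\<in>F \<inter> S. (norm (coeff2 x (\<sigma> g)))\<^sup>2)"
      using F by (intro sum.mono_neutral_cong_right) (auto simp: f)
    also have "\<dots> = (\<Sum>g\<in>\<sigma> ` (F \<inter> S). (norm (coeff2 x g))\<^sup>2)"
      using inj by (subst sum.reindex) (auto simp: inj_on_def)
    also have "\<dots> \<le> (norm x)\<^sup>2" using F by (intro sum_coeff2_le) auto
    finally show "(\<Sum>g\<in>F. (norm (coeff2 (f x) g))\<^sup>2) \<le> (norm x)\<^sup>2" .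
  qed simp
  have "bounded_linear f"
    by (rule bounded_linear_intro[of _ 1]) (auto intro!: ell2_eqI simp: f n)
  then have app: "comp_op S \<sigma> x = f x" for x
    by (simp add: comp_op_def f_def[abs_def] bounded_linear_Blinfun_apply)
  then show "coeff2 (comp_op S \<sigma> x) g = (if g \<in> S then coeff2 x (\<sigma> g) else 0)" by (simp add: f)
  show "norm (comp_op S \<sigma>) \<le> 1"
    by (rule norm_blinfun_bound) (auto simp: app n)
qed

end

lemma blinfun_ell2_eqI: "(\<And>x g. coeff2 (blinfun_apply S x) g = coeff2 (blinfun_apply T x) g) \<Longrightarrow> S = T"
  by (intro blinfun_eqI ell2_eqI) auto

text \<open>Substitution along the bijection moves it to the other argument. This gives both the
  self-adjointness of \<open>carrier_proj\<close> and the adjoints of the right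
  translations.\<close>

lemma comp_op_adjoint:
  assumes "bij_betw \<sigma> S S'" "\<And>g. g \<in> S \<Longrightarrow> \<tau> (\<sigma> g) = g"
  shows "comp_op S \<sigma> x \<bullet> y = x \<bullet> comp_op S' \<tau> y"
proof -
  have \<sigma>: "inj_on \<sigma> S" using assms by (simp add: bij_betw_def)
  have \<tau>: "inj_on \<tau> S'" using assms unfolding bij_betw_def by (auto simp: inj_on_def)
  have "comp_op S \<sigma> x \<bullet> y = (\<Sum>\<^sub>\<infinity>g\<in>S. coeff2 x (\<sigma> g) \<bullet> coeff2 y (\<tau> (\<sigma> g)))"
    unfolding inner_ell2_def using assms(2) by (intro infsum_cong_neutral) (auto simp: coeff2_comp_op[OF \<sigma>])
  also have "\<dots> = (\<Sum>\<^sub>\<infinity>g\<in>S'. coeff2 x g \<bullet> coeff2 y (\<tau> g))"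
    by (rule infsum_reindex_bij_betw[OF assms(1), of "\<lambda>g. coeff2 x g \<bullet> coeff2 y (\<tau> g)"])
  also have "\<dots> = x \<bullet> comp_op S' \<tau> y"
    unfolding inner_ell2_def by (intro infsum_cong_neutral) (auto simp: coeff2_comp_op[OF \<tau>])
  finally show ?thesis .
qed

lemma scale_op_adjoint: "scale_op c x \<bullet> y = x \<bullet> scale_op (cnj c) y"
  unfolding inner_ell2_def by (intro infsum_cong) (simp add: inner_complex_def algebra_simps)

subsection \<open>The group von Neumann algebra as an operator algebra\<close>

definition carrier_proj :: "('g, 'm) monoid_scheme \<Rightarrow> 'g ell2 \<Rightarrow>\<^sub>L 'g ell2" where
  "carrier_proj G = comp_op (carrier G) (\<lambda>g. g)"

definition left_shift :: "('g, 'm) monoid_scheme \<Rightarrow> 'g \<Rightarrow> 'g ell2 \<Rightarrow>\<^sub>L 'g ell2" where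
  "left_shift G a = comp_op (carrier G) (\<lambda>g. inv\<^bsub>G\<^esub> a \<otimes>\<^bsub>G\<^esub> g)"

text \<open>Commuting with the imaginary unit is complex linearity. The two equations with
  \<open>carrier_proj G\<close> make an operator vanish on functions supported off the carrier and
  take values supported on it, so its restriction to \<open>Lp 2 G\<close> determines it.\<close>

definition vN_blinfun :: "('g, 'm) monoid_scheme \<Rightarrow> ('g ell2 \<Rightarrow>\<^sub>L 'g ell2) set" where
  "vN_blinfun G = {T. T o\<^sub>L carrier_proj G = T \<and> carrier_proj G o\<^sub>L T = T \<and> T o\<^sub>L scale_op \<i> = scale_op \<i> o\<^sub>L T \<and>
     (\<forall>a\<in>carrier G. T o\<^sub>L left_shift G a = left_shift G a o\<^sub>L T)}"

definition as_op :: "('g, 'm) monoid_scheme \<Rightarrow> ('g ell2 \<Rightarrow>\<^sub>L 'g ell2) \<Rightarrow> 'g l2_op" where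
  "as_op G T = (\<lambda>x\<in>Lp 2 G. coeff2 (T (Abs_ell2 x)))"

lemma coeff2_carrier_proj [simp]: "coeff2 (carrier_proj G x) g = (if g \<in> carrier G then coeff2 x g else 0)"
  by (simp add: carrier_proj_def coeff2_comp_op)

lemma Lp_coeff2: "coeff2 y \<in> Lp 2 G \<longleftrightarrow> carrier_proj G y = y"
proof
  assume "coeff2 y \<in> Lp 2 G"
  then show "carrier_proj G y = y" by (intro ell2_eqI) (auto simp: Lp_def)
next
  assume "carrier_proj G y = y"
  then have "coeff2 y g = 0" if "g \<notin> carrier G" for g using that by (metis coeff2_carrier_proj)
  then show "coeff2 y \<in> Lp 2 G"
    using summable_on_subset_banach[OF coeff2_summable[of y] subset_UNIV] by (auto simp: Lp_def)
qed

lemma coeff2_Abs [simp]: "x \<in> Lp 2 G \<Longrightarrow> coeff2 (Abs_ell2 x) = x"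
proof -
  assume x: "x \<in> Lp 2 G"
  then have "(\<lambda>g. (norm (x g))\<^sup>2) summable_on UNIV \<longleftrightarrow> (\<lambda>g. (norm (x g))\<^sup>2) summable_on carrier G"
    by (intro summable_on_cong_neutral) (auto simp: Lp_def)
  then show ?thesis using x by (simp add: Abs_ell2_inverse Lp_def)
qed

lemma carrier_proj_Abs: "x \<in> Lp 2 G \<Longrightarrow> carrier_proj G (Abs_ell2 x) = Abs_ell2 x"
  using Lp_coeff2[of "Abs_ell2 x" G] by simp

lemma Lp_E:
  assumes "x \<in> Lp 2 G" obtains X where "x = coeff2 X" "carrier_proj G X = X" "Abs_ell2 x = X"
  using assms carrier_proj_Abs coeff2_Abs by metis

lemma l2_norm_coeff2: "carrier_proj G X = X \<Longrightarrow> l2_norm G (coeff2 X) = norm X"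
proof -
  assume X: "carrier_proj G X = X"
  then have "(\<Sum>\<^sub>\<infinity>g\<in>carrier G. (norm (coeff2 X g))\<^sup>2) = (norm X)\<^sup>2"
    unfolding norm_ell2_squared
    by (intro infsum_cong_neutral) (metis coeff2_carrier_proj DiffE norm_zero zero_power2, auto)
  then show ?thesis by (simp add: l2_norm_def)
qed

text \<open>The imaginary part of a times cnj b is the real part of a times cnj (i b). Thus adjoint
  identities for the real inner product become Hermitian ones for operators commuting with the
  imaginary unit.\<close>

lemma l2_inner_coeff2:
  assumes "carrier_proj G X = X"
  shows "l2_inner G (coeff2 X) (coeff2 Y) = Complex (X \<bullet> Y) (X \<bullet> scale_op \<i> Y)"
proof -
  have "(\<lambda>g. norm (coeff2 X g * cnj (coeff2 Y g))) summable_on UNIV"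
    using inner_summable[OF coeff2_summable[of X] coeff2_summable[of Y]] by (simp add: norm_mult)
  then have s: "(\<lambda>g. coeff2 X g * cnj (coeff2 Y g)) summable_on UNIV" by (rule abs_summable_summable)
  have "l2_inner G (coeff2 X) (coeff2 Y) = (\<Sum>\<^sub>\<infinity>g. coeff2 X g * cnj (coeff2 Y g))"
    unfolding l2_inner_def
    by (intro infsum_cong_neutral) (auto, metis assms coeff2_carrier_proj)
  moreover have "Re (\<Sum>\<^sub>\<infinity>g. coeff2 X g * cnj (coeff2 Y g)) = X \<bullet> Y"
    by (simp add: infsum_Re[OF s, symmetric] inner_ell2_def inner_complex_def)
  moreover have "Im (\<Sum>\<^sub>\<infinity>g. coeff2 X g * cnj (coeff2 Y g)) = X \<bullet> scale_op \<i> Y"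
    by (simp add: infsum_Im[OF s, symmetric] inner_ell2_def inner_complex_def algebra_simps)
  ultimately show ?thesis by (simp add: complex_eq_iff)
qed

lemma as_op_apply: "carrier_proj G X = X \<Longrightarrow> as_op G T (coeff2 X) = coeff2 (T X)"
  by (simp add: as_op_def Lp_coeff2 coeff2_inverse)

lemma scale_coeff2: "(\<lambda>g. c * coeff2 X g) = coeff2 (scale_op c X)"
  by (simp add: fun_eq_iff)

context group
begin

lemma coeff2_left_shift [simp]:
  assumes "a \<in> carrier G"
  shows "coeff2 (left_shift G a x) g = (if g \<in> carrier G then coeff2 x (inv a \<otimes> g) else 0)"
proof -
  have "inj_on (\<lambda>g. inv a \<otimes> g) (carrier G)" using assms by (auto simp: inj_on_def)
  then show ?thesis by (simp add: left_shift_def coeff2_comp_op)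
qed

lemma left_shift_eq_left_mult: "a \<in> carrier G \<Longrightarrow> coeff2 (left_shift G a X) = left_mult G a (coeff2 X)"
  by (simp add: fun_eq_iff left_mult_def)

lemma carrier_proj_idem: "carrier_proj G o\<^sub>L carrier_proj G = carrier_proj G"
  by (rule blinfun_ell2_eqI) simp

lemma carrier_proj_scale_op: "carrier_proj G o\<^sub>L scale_op c = scale_op c o\<^sub>L carrier_proj G"
  by (rule blinfun_ell2_eqI) simp

lemma carrier_proj_left_shift: "a \<in> carrier G \<Longrightarrow> carrier_proj G o\<^sub>L left_shift G a = left_shift G a o\<^sub>L carrier_proj G"
  by (rule blinfun_ell2_eqI) simp

lemma carrier_proj_left_shift_apply: "a \<in> carrier G \<Longrightarrow> carrier_proj G (left_shift G a X) = left_shift G a X"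
  by (rule ell2_eqI) simp

lemma delta_Lp: "delta \<one> \<in> Lp 2 G"
proof -
  have "(\<lambda>g. (norm (delta \<one> g))\<^sup>2) summable_on carrier G"
    by (rule finite_nonzero_values_imp_summable_on) (auto intro: finite_subset[of _ "{\<one>}"] simp: delta_def)
  then show ?thesis by (auto simp: Lp_def delta_def)
qed

definition unit_vec :: "'a ell2" where "unit_vec = Abs_ell2 (delta \<one>)"

lemma coeff2_unit_vec: "coeff2 unit_vec = delta \<one>"
  by (simp add: unit_vec_def coeff2_Abs[OF delta_Lp])

lemma carrier_proj_unit_vec: "carrier_proj G unit_vec = unit_vec"
  using Lp_coeff2[of unit_vec G] delta_Lp by (simp add: coeff2_unit_vec)

lemma inner_unit_vec: "x \<bullet> unit_vec = Re (coeff2 x \<one>)"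
proof -
  have "x \<bullet> unit_vec = (\<Sum>\<^sub>\<infinity>g\<in>{\<one>}. coeff2 x g \<bullet> coeff2 unit_vec g)"
    unfolding inner_ell2_def by (intro infsum_cong_neutral) (auto simp: coeff2_unit_vec delta_def)
  then show ?thesis by (simp add: coeff2_unit_vec delta_def)
qed

lemma norm_unit_vec: "norm unit_vec = 1"
  by (simp add: norm_eq_sqrt_inner inner_unit_vec coeff2_unit_vec delta_def)

text \<open>The conditions in \<open>vN_blinfun\<close> are linear equations that are continuous in
  the operator, hence cut out a closed subspace. The abstract calculus becomes available under the
  prefix \<open>vN\<close>.\<close>

sublocale vN: op_algebra "vN_blinfun G" "carrier_proj G"
proof
  show "closed (vN_blinfun G)"
  proof -
    have "vN_blinfun G = {T. T o\<^sub>L carrier_proj G = T} \<inter> {T. carrier_proj G o\<^sub>L T = T} \<inter> {T. T o\<^sub>L scale_op \<i> = scale_op \<i> o\<^sub>L T} \<inter>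
        (\<Inter>a\<in>carrier G. {T. T o\<^sub>L left_shift G a = left_shift G a o\<^sub>L T})"
      by (auto simp: vN_blinfun_def)
    then show ?thesis
      by (simp only:) (intro closed_Int closed_INT ballI closed_Collect_eq blinfun_compose.continuous_on
          continuous_on_const continuous_on_id)
  qed
  show "subspace (vN_blinfun G)"
    by (auto simp: subspace_def vN_blinfun_def blinfun_compose.add_left blinfun_compose.add_right
        blinfun_compose.scaleR_left blinfun_compose.scaleR_right)
  show "S o\<^sub>L T \<in> vN_blinfun G" if "S \<in> vN_blinfun G" "T \<in> vN_blinfun G" for S T
    using that unfolding vN_blinfun_def by (auto simp: blinfun_compose_assoc) (metis blinfun_compose_assoc)+
  show "carrier_proj G \<in> vN_blinfun G"
    by (simp add: vN_blinfun_def carrier_proj_idem carrier_proj_scale_op carrier_proj_left_shift)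
  show "selfadj (carrier_proj G)"
    unfolding selfadj_def carrier_proj_def by (auto intro!: comp_op_adjoint simp: bij_betw_def)
  show "carrier_proj G \<noteq> 0"
    using carrier_proj_unit_vec norm_unit_vec by auto
qed (auto simp: vN_blinfun_def)

lemma vN_blinfun_apply:
  assumes "T \<in> vN_blinfun G"
  shows "carrier_proj G (T X) = T X" "T (carrier_proj G X) = T X" "T (scale_op \<i> X) = scale_op \<i> (T X)"
    "a \<in> carrier G \<Longrightarrow> T (left_shift G a X) = left_shift G a (T X)"
proof -
  show "carrier_proj G (T X) = T X" "T (carrier_proj G X) = T X" using vN.unit_apply assms by auto
  have "T o\<^sub>L scale_op \<i> = scale_op \<i> o\<^sub>L T" using assms by (simp add: vN_blinfun_def)
  then show "T (scale_op \<i> X) = scale_op \<i> (T X)" by (metis blinfun_apply_blinfun_compose)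
  assume "a \<in> carrier G"
  then have "T o\<^sub>L left_shift G a = left_shift G a o\<^sub>L T" using assms by (simp add: vN_blinfun_def)
  then show "T (left_shift G a X) = left_shift G a (T X)" by (metis blinfun_apply_blinfun_compose)
qed

lemma scale_op_eq: "scale_op c X = Re c *\<^sub>R X + Im c *\<^sub>R scale_op \<i> X"
  by (rule ell2_eqI) (simp add: complex_eq_iff)

lemma vN_blinfun_scale_op: "T \<in> vN_blinfun G \<Longrightarrow> T (scale_op c X) = scale_op c (T X)"
  by (subst (1 2) scale_op_eq) (simp add: blinfun.add_right blinfun.scaleR_right vN_blinfun_apply(3))

lemma add_Lp: "(\<lambda>g. coeff2 X g + coeff2 Y g) = coeff2 (X + Y)"
  by (simp add: fun_eq_iff)

lemma as_op_vN:
  assumes T: "T \<in> vN_blinfun G"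
  shows "as_op G T \<in> vN G"
proof -
  note [simp] = vN_blinfun_apply(1)[OF T]
  have "as_op G T \<in> Lp 2 G \<rightarrow>\<^sub>E Lp 2 G"
    using T by (auto simp: as_op_def Lp_coeff2)
  moreover have "as_op G T (\<lambda>g. x g + y g) = (\<lambda>g. as_op G T x g + as_op G T y g)"
    if "x \<in> Lp 2 G" "y \<in> Lp 2 G" for x y
    using that by (auto elim!: Lp_E simp: add_Lp as_op_apply blinfun.add_right)
  moreover have "as_op G T (\<lambda>g. c * x g) = (\<lambda>g. c * as_op G T x g)" if "x \<in> Lp 2 G" for x c
  proof -
    obtain X where X: "x = coeff2 X" "carrier_proj G X = X" using \<open>x \<in> Lp 2 G\<close> by (elim Lp_E)
    have "carrier_proj G (scale_op c X) = scale_op c X" using X(2) by (metis blinfun_apply_blinfun_compose carrier_proj_scale_op)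
    then show ?thesis using X by (simp add: scale_coeff2 as_op_apply vN_blinfun_scale_op[OF T] del: coeff2_scale_op)
  qed
  moreover have "l2_norm G (as_op G T x) \<le> norm T * l2_norm G x" if "x \<in> Lp 2 G" for x
    using that by (auto elim!: Lp_E simp: as_op_apply l2_norm_coeff2 norm_blinfun)
  moreover have "as_op G T (left_mult G a x) = left_mult G a (as_op G T x)"
    if "a \<in> carrier G" "x \<in> Lp 2 G" for a x
    using that
    by (auto elim!: Lp_E simp: as_op_apply vN_blinfun_apply(4)[OF T] carrier_proj_left_shift_apply simp flip: left_shift_eq_left_mult)
  ultimately show ?thesis unfolding vN_def bounded_ops_def by blast
qed

lemma as_op_inj:
  assumes "S \<in> vN_blinfun G" "T \<in> vN_blinfun G" "as_op G S = as_op G T"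
  shows "S = T"
proof (rule blinfun_ell2_eqI)
  fix x g
  have "carrier_proj G (carrier_proj G x) = carrier_proj G x" by (metis blinfun_apply_blinfun_compose carrier_proj_idem)
  then have "coeff2 (S (carrier_proj G x)) = coeff2 (T (carrier_proj G x))"
    using as_op_apply[of G "carrier_proj G x" S] as_op_apply[of G "carrier_proj G x" T] assms(3) by simp
  then show "coeff2 (S x) g = coeff2 (T x) g" using vN_blinfun_apply(2) assms by metis
qed

text \<open>Composing \<open>A\<close> with the projection extends it by zero off the carrier.
  Together with \<open>as_op_vN\<close> and \<open>as_op_inj\<close> this makes \<open>as_op\<close>
  a bijection onto \<open>vN G\<close>, so uniqueness in the definite descriptions can be checked
  among bounded linear operators.\<close>

lemma as_op_surj:
  assumes A: "A \<in> vN G"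
  obtains T where "T \<in> vN_blinfun G" "A = as_op G T"
proof -
  have AE: "A \<in> Lp 2 G \<rightarrow>\<^sub>E Lp 2 G"
    and add: "\<And>x y. x \<in> Lp 2 G \<Longrightarrow> y \<in> Lp 2 G \<Longrightarrow> A (\<lambda>g. x g + y g) = (\<lambda>g. A x g + A y g)"
    and scale: "\<And>c x. x \<in> Lp 2 G \<Longrightarrow> A (\<lambda>g. c * x g) = (\<lambda>g. c * A x g)"
    and left: "\<And>a x. a \<in> carrier G \<Longrightarrow> x \<in> Lp 2 G \<Longrightarrow> A (left_mult G a x) = left_mult G a (A x)"
    using A unfolding vN_def bounded_ops_def by blast+
  obtain C where C: "\<And>x. x \<in> Lp 2 G \<Longrightarrow> l2_norm G (A x) \<le> C * l2_norm G x"
    using A unfolding vN_def bounded_ops_def by blast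
  have pp: "carrier_proj G (carrier_proj G X) = carrier_proj G X" for X by (metis blinfun_apply_blinfun_compose carrier_proj_idem)
  have P [simp]: "coeff2 (carrier_proj G X) \<in> Lp 2 G" for X by (simp add: Lp_coeff2 pp)
  have AP [simp]: "A (coeff2 (carrier_proj G X)) \<in> Lp 2 G" for X using AE P by blast
  define f where "f X = Abs_ell2 (A (coeff2 (carrier_proj G X)))" for X
  have f: "coeff2 (f X) = A (coeff2 (carrier_proj G X))" for X
    unfolding f_def by (rule coeff2_Abs[OF AP])
  have pf: "carrier_proj G (f X) = f X" for X unfolding f_def by (rule carrier_proj_Abs[OF AP])
  have lin: "bounded_linear f"
  proof (rule bounded_linear_intro)
    show "f (X + Y) = f X + f Y" for X Y
      by (rule ell2_eqI) (simp add: f blinfun.add_right add[OF P P] del: coeff2_carrier_proj coeff2_simps flip: add_Lp)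
    show "f (r *\<^sub>R X) = r *\<^sub>R f X" for r X
    proof -
      have "coeff2 (carrier_proj G (r *\<^sub>R X)) = (\<lambda>g. of_real r * coeff2 (carrier_proj G X) g)"
        by (simp add: fun_eq_iff scaleR_conv_of_real)
      then show ?thesis by (intro ell2_eqI) (simp add: f scale[OF P] scaleR_conv_of_real del: coeff2_carrier_proj)
    qed
    show "norm (f X) \<le> norm X * \<bar>C\<bar>" for X
    proof -
      have "norm (f X) = l2_norm G (A (coeff2 (carrier_proj G X)))" by (metis f l2_norm_coeff2 pf)
      also have "\<dots> \<le> C * norm (carrier_proj G X)" using C[OF P] by (metis l2_norm_coeff2 pp)
      also have "\<dots> \<le> \<bar>C\<bar> * norm X" by (intro mult_mono vN.norm_unit_apply) auto
      finally show ?thesis by (simp add: mult.commute)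
    qed
  qed
  define T where "T = Blinfun f"
  have T: "T X = f X" for X by (simp add: T_def bounded_linear_Blinfun_apply[OF lin])
  have TG: "T \<in> vN_blinfun G"
  proof -
    have "f (scale_op \<i> X) = scale_op \<i> (f X)" for X
    proof (rule ell2_eqI)
      have "coeff2 (carrier_proj G (scale_op \<i> X)) = (\<lambda>g. \<i> * coeff2 (carrier_proj G X) g)" by (simp add: fun_eq_iff)
      then show "coeff2 (f (scale_op \<i> X)) g = coeff2 (scale_op \<i> (f X)) g" for g
        by (simp add: f scale[OF P] del: coeff2_carrier_proj)
    qed
    moreover have "f (left_shift G a X) = left_shift G a (f X)" if "a \<in> carrier G" for a X
    proof -
      have "carrier_proj G (left_shift G a X) = left_shift G a (carrier_proj G X)"
        using carrier_proj_left_shift[OF that] by (metis blinfun_apply_blinfun_compose)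
      then have "coeff2 (f (left_shift G a X)) = coeff2 (left_shift G a (f X))"
        using that by (simp only: f left_shift_eq_left_mult left[OF that P])
      then show ?thesis by (simp add: coeff2_inject)
    qed
    ultimately show ?thesis
      unfolding vN_blinfun_def by (auto intro!: blinfun_eqI simp: T pf) (simp add: f_def pp)
  qed
  have "A x = as_op G T x" if "x \<in> Lp 2 G" for x
    using that by (elim Lp_E) (simp add: as_op_apply T f del: coeff2_carrier_proj)
  then have "A = as_op G T"
    using AE as_op_vN[OF TG] unfolding vN_def bounded_ops_def
    by (intro PiE_ext[of _ "Lp 2 G" "\<lambda>_. Lp 2 G"]) auto
  then show ?thesis using that TG by blast
qed

section \<open>Translation of the operations on \<open>vN G\<close> to bounded linear
  operators\<close>

lemma as_op_eqI:
  "(\<And>X. carrier_proj G X = X \<Longrightarrow> f (coeff2 X) = coeff2 (blinfun_apply T X)) \<Longrightarrow> restrict f (Lp 2 G) = as_op G T"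
  unfolding as_op_def
proof (rule restrict_ext)
  fix x assume *: "\<And>X. carrier_proj G X = X \<Longrightarrow> f (coeff2 X) = coeff2 (blinfun_apply T X)" and x: "x \<in> Lp 2 G"
  show "f x = coeff2 (blinfun_apply T (Abs_ell2 x))" using *[OF carrier_proj_Abs[OF x]] x by simp
qed

lemma op_diff_as_op:
  "op_diff G (as_op G S) (as_op G T) = as_op G (S - T)"
  unfolding op_diff_def by (rule as_op_eqI) (auto simp: as_op_apply blinfun.diff_left)

lemma op_mult_as_op:
  "T \<in> vN_blinfun G \<Longrightarrow> op_mult G (as_op G S) (as_op G T) = as_op G (S o\<^sub>L T)"
  unfolding op_mult_def compose_def by (rule as_op_eqI) (auto simp: as_op_apply vN_blinfun_apply(1))

lemma op_id_as_op: "op_id G = as_op G (carrier_proj G)"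
  unfolding op_id_def by (rule as_op_eqI) simp

lemma op_shift_as_op:
  "op_shift G (as_op G T) (of_real c) = as_op G (T + c *\<^sub>R carrier_proj G)"
  unfolding op_shift_def
  by (rule as_op_eqI) (auto simp: as_op_apply blinfun.add_left blinfun.scaleR_left scaleR_conv_of_real
      simp del: coeff2_carrier_proj)

lemma funpow_as_op:
  assumes "T \<in> vN_blinfun G" "carrier_proj G X = X"
  shows "(as_op G T ^^ i) (coeff2 X) = coeff2 (vN.power_op T i X)"
  using vN.power_op_A[OF assms(1)] assms by (induction i) (simp_all add: as_op_apply vN_blinfun_apply)

lemma op_poly_as_op:
  assumes "T \<in> vN_blinfun G"
  shows "op_poly G p (as_op G T) = as_op G (vN.poly_op p T)"
proof -
  have co: "coeff2 (\<Sum>i\<in>F. h i) g = (\<Sum>i\<in>F. coeff2 (h i) g)" for F :: "nat set" and h :: "nat \<Rightarrow> 'a ell2" and g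
    by (induction F rule: infinite_finite_induct) auto
  show ?thesis
    unfolding op_poly_def
    by (rule as_op_eqI)
       (auto simp: funpow_as_op assms vN.poly_op_eq_sum blinfun.sum_left blinfun.scaleR_left co scaleR_conv_of_real)
qed

lemma op_norm_as_op:
  assumes T: "T \<in> vN_blinfun G"
  shows "op_norm G (as_op G T) = norm T"
proof (rule antisym)
  have eq: "l2_norm G (as_op G T (coeff2 X)) = norm (T X)" if "carrier_proj G X = X" for X
    using that by (simp add: as_op_apply l2_norm_coeff2 vN_blinfun_apply(1)[OF T])
  have le: "l2_norm G (as_op G T x) \<le> norm T" if "x \<in> {x \<in> Lp 2 G. l2_norm G x \<le> 1}" for x
  proof -
    obtain X where X: "x = coeff2 X" "carrier_proj G X = X" using \<open>x \<in> _\<close> by (auto elim: Lp_E)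
    then have "norm X \<le> 1" using that by (simp add: l2_norm_coeff2)
    then have "norm T * norm X \<le> norm T * 1" by (intro mult_left_mono) auto
    then have "norm (T X) \<le> norm T" using norm_blinfun[of T X] by linarith
    then show ?thesis using X eq by simp
  qed
  have zero: "coeff2 (0 :: 'a ell2) \<in> {x \<in> Lp 2 G. l2_norm G x \<le> 1}"
    by (simp add: Lp_coeff2 l2_norm_coeff2 del: coeff2_simps)
  show "op_norm G (as_op G T) \<le> norm T"
    unfolding op_norm_def using le zero by (intro cSUP_least) blast+
  have bdd: "bdd_above ((\<lambda>x. l2_norm G (as_op G T x)) ` {x \<in> Lp 2 G. l2_norm G x \<le> 1})"
    using le by (intro bdd_aboveI[of _ "norm T"]) blast
  have "0 \<le> op_norm G (as_op G T)"
    unfolding op_norm_def by (rule cSUP_upper2[OF bdd zero]) (simp add: eq del: coeff2_simps)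
  then show "norm T \<le> op_norm G (as_op G T)"
  proof (rule vN.norm_le_unitI[OF T])
    fix X
    let ?Y = "carrier_proj G X"
    have pp: "carrier_proj G ?Y = ?Y" by (metis blinfun_apply_blinfun_compose carrier_proj_idem)
    show "norm (T X) \<le> op_norm G (as_op G T) * norm ?Y"
    proof (cases "?Y = 0")
      case True
      then show ?thesis using vN_blinfun_apply(2)[OF T, of X] by simp
    next
      case False
      define Z where "Z = ?Y /\<^sub>R norm ?Y"
      have Z: "carrier_proj G Z = Z" "norm Z = 1" using False pp by (auto simp: Z_def blinfun.scaleR_right)
      have "norm (T Z) \<le> op_norm G (as_op G T)"
        unfolding op_norm_def using Z by (intro cSUP_upper2[OF bdd, of "coeff2 Z"]) (auto simp: eq Lp_coeff2 l2_norm_coeff2)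
      moreover have "T Z = T X /\<^sub>R norm ?Y" by (simp add: Z_def blinfun.scaleR_right vN_blinfun_apply(2)[OF T])
      ultimately show ?thesis using False by (simp add: field_simps)
    qed
  qed
qed

lemma vN_invertible_as_op:
  assumes T: "T \<in> vN_blinfun G"
  shows "vN_invertible G (as_op G T) \<longleftrightarrow> vN.invertible T"
proof
  assume "vN_invertible G (as_op G T)"
  then obtain B where B: "B \<in> vN G" "op_mult G (as_op G T) B = op_id G" "op_mult G B (as_op G T) = op_id G"
    by (auto simp: vN_invertible_def)
  obtain R where R: "R \<in> vN_blinfun G" "B = as_op G R" using as_op_surj[OF B(1)] .
  have "T o\<^sub>L R = carrier_proj G" "R o\<^sub>L T = carrier_proj G"
    using B R T by (auto intro!: as_op_inj simp: op_mult_as_op op_id_as_op vN.compose_A vN.unit_A)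
  then show "vN.invertible T" using R by (auto simp: vN.invertible_def)
next
  assume "vN.invertible T"
  then obtain R where "R \<in> vN_blinfun G" "T o\<^sub>L R = carrier_proj G" "R o\<^sub>L T = carrier_proj G"
    by (auto simp: vN.invertible_def)
  then show "vN_invertible G (as_op G T)"
    unfolding vN_invertible_def using T
    by (auto intro!: bexI[of _ "as_op G R"] simp: as_op_vN op_mult_as_op op_id_as_op)
qed

lemma op_spectrum_as_op:
  assumes T: "T \<in> vN_blinfun G"
  shows "{t. complex_of_real t \<in> op_spectrum G (as_op G T)} = vN.real_spectrum T"
  unfolding op_spectrum_def vN.real_spectrum_def
  using op_shift_as_op[of T "- t" for t] T
  by (auto simp: vN_invertible_as_op vN.diff_A vN.scaleR_A vN.unit_A)

text \<open>The adjoint is passed in as \<open>T'\<close> because it is explicit in every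
  application: it comes from the involution \<open>star\<close>, or the operator is
  self-adjoint.\<close>

lemma op_adjoint_as_op:
  assumes T: "T \<in> vN_blinfun G" "T' \<in> vN_blinfun G" and adj: "\<And>x y. T x \<bullet> y = x \<bullet> T' y"
  shows "op_adjoint G (as_op G T) = as_op G T'"
  unfolding op_adjoint_def
proof (rule the_equality)
  show "as_op G T' \<in> vN G \<and> (\<forall>x\<in>Lp 2 G. \<forall>y\<in>Lp 2 G. l2_inner G (as_op G T x) y = l2_inner G x (as_op G T' y))"
  proof (intro conjI ballI as_op_vN T)
    fix x y assume "x \<in> Lp 2 G" "y \<in> Lp 2 G"
    then show "l2_inner G (as_op G T x) y = l2_inner G x (as_op G T' y)"
      by (elim Lp_E)
         (simp add: as_op_apply l2_inner_coeff2 vN_blinfun_apply(1)[OF T(1)] adj vN_blinfun_apply(3)[OF T(2)])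
  qed
next
  fix B assume B: "B \<in> vN G \<and> (\<forall>x\<in>Lp 2 G. \<forall>y\<in>Lp 2 G. l2_inner G (as_op G T x) y = l2_inner G x (B y))"
  obtain R where R: "R \<in> vN_blinfun G" "B = as_op G R" using as_op_surj B by blast
  have "R x = T' x" for x
  proof -
    have p: "carrier_proj G (carrier_proj G z) = carrier_proj G z" for z by (metis blinfun_apply_blinfun_compose carrier_proj_idem)
    \<comment> \<open>Testing both adjoint identities against this difference gives
      \<open>?d \<bullet> ?d = 0\<close>.\<close>
    let ?d = "R x - T' x"
    have pd: "carrier_proj G ?d = ?d" by (simp add: blinfun.diff_right vN_blinfun_apply(1) R T)
    have "l2_inner G (as_op G T (coeff2 ?d)) (coeff2 (carrier_proj G x)) = l2_inner G (coeff2 ?d) (B (coeff2 (carrier_proj G x)))"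
      using B pd p by (simp add: Lp_coeff2 del: coeff2_simps)
    then have "T ?d \<bullet> carrier_proj G x = ?d \<bullet> R (carrier_proj G x)"
      unfolding R(2) as_op_apply[OF pd] as_op_apply[OF p]
      by (subst (asm) (1 2) l2_inner_coeff2) (auto simp: pd vN_blinfun_apply(1)[OF T(1)])
    then have "?d \<bullet> T' x = ?d \<bullet> R x"
      by (simp only: adj vN_blinfun_apply(2)[OF T(2)] vN_blinfun_apply(2)[OF R(1)])
    then have "?d \<bullet> ?d = 0" by (simp only: inner_diff_right)
    then show ?thesis by simp
  qed
  then show "B = as_op G T'" using R blinfun_eqI by metis
qed

text \<open>\<open>fun_calc\<close> refers to the spectrum itself, \<open>calculus\<close> to any
  larger \<open>I\<close>. Restriction preserves the limit, and uniqueness on the spectrum evaluates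
  the definite description.\<close>

lemma fun_calc_as_op:
  assumes B: "B \<in> vN_blinfun G" "selfadj B" and I: "vN.real_spectrum B \<subseteq> I" and C: "vN.calculus B I v C"
  shows "fun_calc G v (as_op G B) = as_op G C"
  unfolding fun_calc_def op_spectrum_as_op[OF B(1)]
proof (rule the_equality)
  have CG: "C \<in> vN_blinfun G" using vN.calculus_A[OF B I C] .
  have norm_eq: "op_norm G (op_diff G (op_poly G p (as_op G B)) (as_op G D)) = norm (vN.poly_op p B - D)"
    if "D \<in> vN_blinfun G" for p D
    using that B by (simp add: op_poly_as_op op_diff_as_op op_norm_as_op vN.diff_A vN.poly_op_A)
  have C': "vN.calculus B (vN.real_spectrum B) v C" using vN.calculus_subset[OF C I] .
  then show "as_op G C \<in> vN G \<and> (\<exists>p. uniform_limit (vN.real_spectrum B) (\<lambda>n. poly (p n)) v sequentially \<and>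
      (\<lambda>n. op_norm G (op_diff G (op_poly G (p n) (as_op G B)) (as_op G C))) \<longlonglongrightarrow> 0)"
    unfolding norm_eq[OF CG] vN.calculus_def using as_op_vN[OF CG] LIM_zero tendsto_norm_zero by blast
  fix D assume D: "D \<in> vN G \<and> (\<exists>p. uniform_limit (vN.real_spectrum B) (\<lambda>n. poly (p n)) v sequentially \<and>
      (\<lambda>n. op_norm G (op_diff G (op_poly G (p n) (as_op G B)) D)) \<longlonglongrightarrow> 0)"
  obtain D' where D': "D' \<in> vN_blinfun G" "D = as_op G D'" using as_op_surj D by blast
  obtain p where p: "uniform_limit (vN.real_spectrum B) (\<lambda>n. poly (p n)) v sequentially"
    "(\<lambda>n. norm (vN.poly_op (p n) B - D')) \<longlonglongrightarrow> 0"
    using D D' norm_eq[OF D'(1)] by auto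
  have "(\<lambda>n. vN.poly_op (p n) B) \<longlonglongrightarrow> D'"
    using p(2) by (simp add: tendsto_norm_zero_iff LIM_zero_iff)
  then have "vN.calculus B (vN.real_spectrum B) v D'"
    unfolding vN.calculus_def using p(1) by blast
  then show "D = as_op G C" using vN.calculus_unique[OF B order_refl C'] D' by simp
qed

lemma vN_trace_as_op: "T \<in> vN_blinfun G \<Longrightarrow> Re (vN_trace G (as_op G T)) = T unit_vec \<bullet> unit_vec"
  unfolding vN_trace_def
  by (simp flip: coeff2_unit_vec add: as_op_apply carrier_proj_unit_vec l2_inner_coeff2 vN_blinfun_apply(1))

end

subsection \<open>The determinant\<close>

context group
begin

definition fun_trace :: "('a ell2 \<Rightarrow>\<^sub>L 'a ell2) \<Rightarrow> real set \<Rightarrow> (real \<Rightarrow> real) \<Rightarrow> real" where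
  "fun_trace H I u = (THE B. vN.calculus H I u B) unit_vec \<bullet> unit_vec"

context
  fixes H I
  assumes H: "H \<in> vN_blinfun G" "selfadj H" "vN.real_spectrum H \<subseteq> I" and compact_I: "compact I"
begin

lemma fun_trace_eq: "vN.calculus H I u B \<Longrightarrow> fun_trace H I u = B unit_vec \<bullet> unit_vec"
  unfolding fun_trace_def using vN.calculus_unique[OF H] by (metis the_equality)

lemma fun_trace_poly: "fun_trace H I (poly p) = vN.poly_op p H unit_vec \<bullet> unit_vec"
  by (rule fun_trace_eq) (use vN.calculus_poly_op[OF H compact_I vN.calculus_id[OF H]] in simp)

text \<open>\<open>unit_vec\<close> has norm one, so the trace of an operator is bounded by its
  norm.\<close>

lemma fun_trace_diff_le:
  assumes "continuous_on I u" "continuous_on I v" "\<And>t. t \<in> I \<Longrightarrow> \<bar>u t - v t\<bar> \<le> \<delta>"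
  shows "\<bar>fun_trace H I u - fun_trace H I v\<bar> \<le> \<delta>"
proof -
  obtain B C where B: "vN.calculus H I u B" and C: "vN.calculus H I v C"
    using vN.calculus_exists[OF H compact_I] assms by meson
  have "\<bar>(B - C) unit_vec \<bullet> unit_vec\<bar> \<le> norm ((B - C) unit_vec) * norm unit_vec" by (rule Cauchy_Schwarz_ineq2)
  also have "\<dots> \<le> norm (B - C)" using norm_blinfun[of "B - C" unit_vec] by (simp add: norm_unit_vec)
  also have "\<dots> \<le> \<delta>" using vN.calculus_norm_diff[OF H B C] assms(3) by blast
  finally show ?thesis by (simp add: fun_trace_eq[OF B] fun_trace_eq[OF C] blinfun.diff_left inner_diff_left)
qed

text \<open>The function \<open>v - u\<close> is the square of a continuous function, so the
  difference of the two operators is \<open>S o\<^sub>L S\<close> with \<open>S\<close>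
  self-adjoint, whose trace is a squared norm.\<close>

lemma fun_trace_mono:
  assumes "continuous_on I u" "continuous_on I v" "\<And>t. t \<in> I \<Longrightarrow> u t \<le> v t"
  shows "fun_trace H I u \<le> fun_trace H I v"
proof -
  have "continuous_on I (\<lambda>t. sqrt (v t - u t))" by (intro continuous_intros assms)
  then obtain B S where B: "vN.calculus H I u B" and S: "vN.calculus H I (\<lambda>t. sqrt (v t - u t)) S"
    using vN.calculus_exists[OF H compact_I] assms by meson
  have "vN.calculus H I v (B + (S o\<^sub>L S))"
    by (rule vN.calculus_cong[OF vN.calculus_add[OF H B vN.calculus_mult[OF H compact_I S S]]]) (use assms in simp)
  then have "fun_trace H I v = fun_trace H I u + S (S unit_vec) \<bullet> unit_vec"
    by (simp add: fun_trace_eq fun_trace_eq[OF B] blinfun.add_left inner_add_left)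
  moreover have "S (S unit_vec) \<bullet> unit_vec = (norm (S unit_vec))\<^sup>2"
    by (rule vN.selfadj_power2_inner[OF vN.calculus_selfadj[OF H S]])
  ultimately show ?thesis by simp
qed

end

lemma op_abs_as_op:
  assumes T: "T \<in> vN_blinfun G" "T' \<in> vN_blinfun G" "\<And>x y. T x \<bullet> y = x \<bullet> T' y"
    and H: "selfadj (T' o\<^sub>L T)" "vN.real_spectrum (T' o\<^sub>L T) \<subseteq> I" and B: "vN.calculus (T' o\<^sub>L T) I sqrt B"
  shows "op_abs G (as_op G T) = as_op G B"
  unfolding op_abs_def op_adjoint_as_op[OF T] op_mult_as_op[OF T(1)]
  by (rule fun_calc_as_op[OF vN.compose_A[OF T(2,1)] H B])

text \<open>Everything that the definition of the determinant builds from \<open>T\<close> is a continuous function of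
  \<open>H = T\<^sup>* T\<close>, and the continuous calculus composes.\<close>

lemma fk_det_invertible_shift:
  assumes T: "T \<in> vN_blinfun G" "T' \<in> vN_blinfun G" "\<And>x y. T x \<bullet> y = x \<bullet> T' y"
    and H: "H = T' o\<^sub>L T" "vN.real_spectrum H \<subseteq> I" and I: "compact I" "I \<subseteq> {0..}" and \<epsilon>: "\<epsilon> > 0"
  shows "fk_det_invertible G (op_shift G (op_abs G (as_op G T)) (complex_of_real \<epsilon>)) =
    exp (fun_trace H I (\<lambda>t. ln (sqrt t + \<epsilon>)))"
proof -
  have HG: "H \<in> vN_blinfun G" using T vN.compose_A H(1) by simp
  have sa: "selfadj H" using T(3) by (simp add: H(1) selfadj_def) (metis inner_commute)
  note H' = HG sa H(2)
  have pos: "sqrt t + \<epsilon> > 0" if "t \<in> I" for t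
    using add_nonneg_pos[OF _ \<epsilon>, of "sqrt t"] subsetD[OF I(2) that] by simp
  have c: "continuous_on I sqrt" "continuous_on I (\<lambda>t. ln (sqrt t + \<epsilon>))"
    using pos by (force intro!: continuous_intros)+
  obtain B D where B: "vN.calculus H I sqrt B" and D: "vN.calculus H I (\<lambda>t. ln (sqrt t + \<epsilon>)) D"
    using vN.calculus_exists[OF H' I(1)] c by meson
  define S where "S = B + \<epsilon> *\<^sub>R carrier_proj G"
  have S: "vN.calculus H I (\<lambda>t. sqrt t + \<epsilon>) S"
    unfolding S_def by (rule vN.calculus_add[OF H' B vN.calculus_const[OF H']])
  have SG: "S \<in> vN_blinfun G" and Ssa: "selfadj S"
    using vN.calculus_A[OF H' S] vN.calculus_selfadj[OF H' S] by auto
  have SS: "vN.calculus H I (\<lambda>t. (sqrt t + \<epsilon>) * (sqrt t + \<epsilon>)) (S o\<^sub>L S)"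
    by (rule vN.calculus_mult[OF H' I(1) S S])
  have shift: "op_shift G (op_abs G (as_op G T)) (complex_of_real \<epsilon>) = as_op G S"
    using op_abs_as_op[OF T] sa H B by (simp add: S_def op_shift_as_op)
  \<comment> \<open>\<open>fk_det_invertible\<close> takes an absolute value once more. The shifted
    operator is its own absolute value, since the square root of (sqrt t + \<epsilon>)^2 is sqrt t +
    \<epsilon>.\<close>
  have abs: "op_abs G (as_op G S) = as_op G S"
  proof (rule op_abs_as_op[OF SG SG])
    show "S x \<bullet> y = x \<bullet> S y" for x y using Ssa by (rule selfadjD)
    show "selfadj (S o\<^sub>L S)" using vN.calculus_selfadj[OF H' SS] .
    show "vN.real_spectrum (S o\<^sub>L S) \<subseteq> (\<lambda>t. (sqrt t + \<epsilon>) * (sqrt t + \<epsilon>)) ` I" by (rule vN.real_spectrum_calculus[OF H' I(1) SS])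
    show "vN.calculus (S o\<^sub>L S) ((\<lambda>t. (sqrt t + \<epsilon>) * (sqrt t + \<epsilon>)) ` I) sqrt S"
    proof (rule vN.calculus_compose[OF H' I(1) SS])
      show "vN.calculus H I (\<lambda>t. sqrt ((sqrt t + \<epsilon>) * (sqrt t + \<epsilon>))) S"
        using I(2) \<epsilon> by (intro vN.calculus_cong[OF S]) (auto dest!: subsetD)
    qed (intro continuous_intros)
  qed
  have "fun_calc G ln (as_op G S) = as_op G D"
  proof (rule fun_calc_as_op[OF SG Ssa vN.real_spectrum_calculus[OF H' I(1) S]])
    show "vN.calculus S ((\<lambda>t. sqrt t + \<epsilon>) ` I) ln D"
    proof (rule vN.calculus_compose[OF H' I(1) S _ D])
      show "continuous_on ((\<lambda>t. sqrt t + \<epsilon>) ` I) ln"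
        using pos by (intro continuous_intros) force
    qed
  qed
  then show ?thesis
    unfolding fk_det_invertible_def shift abs
    using vN_trace_as_op[OF vN.calculus_A[OF H' D]] fun_trace_eq[OF H' I(1) D] by simp
qed

lemma fk_det_eqI:
  assumes "T \<in> vN_blinfun G" "T' \<in> vN_blinfun G" "\<And>x y. T x \<bullet> y = x \<bullet> T' y"
    "H = T' o\<^sub>L T" "vN.real_spectrum H \<subseteq> I" "compact I" "I \<subseteq> {0..}"
    and L: "((\<lambda>\<epsilon>. exp (fun_trace H I (\<lambda>t. ln (sqrt t + \<epsilon>)))) \<longlongrightarrow> L) (at_right 0)"
  shows "fk_det G (as_op G T) = L"
  unfolding fk_det_def
proof (rule tendsto_Lim)
  show "((\<lambda>\<epsilon>. fk_det_invertible G (op_shift G (op_abs G (as_op G T)) (complex_of_real \<epsilon>))) \<longlongrightarrow> L) (at_right 0)"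
    by (rule Lim_transform_eventually[OF L])
       (auto simp: eventually_at_right_less fk_det_invertible_shift[OF assms(1-7)]
         intro!: eventually_mono[OF eventually_at_right_less[of 0]])
qed simp

text \<open>The shifted determinants increase with \<epsilon> and are bounded below by 0, so their
  limit at 0 exists and equals their infimum. Existence matters because \<open>Lim\<close> says
  nothing about divergent functions.\<close>

lemma fk_det_as_op:
  assumes T: "T \<in> vN_blinfun G" "T' \<in> vN_blinfun G" "\<And>x y. T x \<bullet> y = x \<bullet> T' y"
    and H: "H = T' o\<^sub>L T" "vN.real_spectrum H \<subseteq> I" and I: "compact I" "I \<subseteq> {0..}"
  shows "\<epsilon> > 0 \<Longrightarrow> fk_det G (as_op G T) \<le> exp (fun_trace H I (\<lambda>t. ln (sqrt t + \<epsilon>)))"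
    and "((\<lambda>\<epsilon>. exp (fun_trace H I (\<lambda>t. ln (sqrt t + \<epsilon>)))) \<longlongrightarrow> fk_det G (as_op G T)) (at_right 0)"
proof -
  have HG: "H \<in> vN_blinfun G" using T vN.compose_A H(1) by simp
  have sa: "selfadj H" using T(3) by (simp add: H(1) selfadj_def) (metis inner_commute)
  define F where "F \<epsilon> = exp (fun_trace H I (\<lambda>t. ln (sqrt t + \<epsilon>)))" for \<epsilon>
  have mono: "F \<epsilon> \<le> F \<epsilon>'" if "0 < \<epsilon>" "\<epsilon> \<le> \<epsilon>'" for \<epsilon> \<epsilon>'
  proof -
    have pos: "0 < sqrt t + \<epsilon>" "0 < sqrt t + \<epsilon>'" if "t \<in> I" for t
      using that I(2) \<open>0 < \<epsilon>\<close> \<open>\<epsilon> \<le> \<epsilon>'\<close> by (auto dest!: subsetD intro: add_nonneg_pos)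
    then show ?thesis
      unfolding F_def exp_le_cancel_iff using \<open>\<epsilon> \<le> \<epsilon>'\<close>
      by (intro fun_trace_mono[OF HG sa H(2) I(1)] continuous_intros) (force intro: less_imp_le)+
  qed
  define L where "L = Inf (F ` {0<..})"
  have bdd: "bdd_below (F ` {0<..})" by (rule bdd_belowI[of _ 0]) (auto simp: F_def)
  have le: "L \<le> F \<epsilon>" if "\<epsilon> > 0" for \<epsilon> using that bdd by (auto simp: L_def intro: cInf_lower)
  have lim: "(F \<longlongrightarrow> L) (at_right 0)"
  proof (rule order_tendstoI)
    fix a assume "a < L"
    then show "\<forall>\<^sub>F \<epsilon> in at_right 0. a < F \<epsilon>"
      using le by (intro eventually_mono[OF eventually_at_right_less[of 0]]) (auto intro: less_le_trans)
  next
    fix a assume "L < a"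
    then obtain \<epsilon>0 where e0: "\<epsilon>0 > 0" "F \<epsilon>0 < a"
      unfolding L_def using cInf_lessD[of "F ` {0<..}" a] by auto
    have "\<forall>\<^sub>F \<epsilon> in at_right 0. 0 < \<epsilon> \<and> \<epsilon> < \<epsilon>0"
      using e0(1) by (auto simp: eventually_at_right_field)
    then show "\<forall>\<^sub>F \<epsilon> in at_right 0. F \<epsilon> < a"
      using mono e0 by (auto elim!: eventually_mono intro: le_less_trans less_imp_le)
  qed
  have "fk_det G (as_op G T) = L"
    using fk_det_eqI[OF T H I] lim unfolding F_def by blast
  then show "\<epsilon> > 0 \<Longrightarrow> fk_det G (as_op G T) \<le> exp (fun_trace H I (\<lambda>t. ln (sqrt t + \<epsilon>)))"
    "((\<lambda>\<epsilon>. exp (fun_trace H I (\<lambda>t. ln (sqrt t + \<epsilon>)))) \<longlongrightarrow> fk_det G (as_op G T)) (at_right 0)"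
    using le lim by (auto simp: F_def[abs_def])
qed

text \<open>On \<open>I\<close> the square root is at least \<open>c\<close>, so adding \<epsilon>
  changes the logarithm by at most \<epsilon>/c, and the shift disappears in the limit.\<close>

lemma fk_det_bounded_below:
  assumes T: "T \<in> vN_blinfun G" "T' \<in> vN_blinfun G" "\<And>x y. T x \<bullet> y = x \<bullet> T' y"
    and H: "H = T' o\<^sub>L T" "vN.real_spectrum H \<subseteq> I" and I: "compact I" "I \<subseteq> {c\<^sup>2..}" and c: "c > 0"
  shows "fk_det G (as_op G T) = exp (fun_trace H I (\<lambda>t. ln (sqrt t)))"
proof (rule fk_det_eqI[OF T H I(1)])
  have HG: "H \<in> vN_blinfun G" using T vN.compose_A H(1) by simp
  have sa: "selfadj H" using T(3) by (simp add: H(1) selfadj_def) (metis inner_commute)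
  show "I \<subseteq> {0..}" using I(2) c by (auto intro: order_trans[OF zero_le_power2])
  have sq: "c \<le> sqrt t" if "t \<in> I" for t using that I(2) c by (auto intro: real_le_rsqrt)
  have "((\<lambda>\<epsilon>. fun_trace H I (\<lambda>t. ln (sqrt t + \<epsilon>)) - fun_trace H I (\<lambda>t. ln (sqrt t))) \<longlongrightarrow> 0) (at_right 0)"
  proof (rule Lim_null_comparison)
    show "\<forall>\<^sub>F \<epsilon> in at_right 0. norm (fun_trace H I (\<lambda>t. ln (sqrt t + \<epsilon>)) - fun_trace H I (\<lambda>t. ln (sqrt t))) \<le> \<epsilon> / c"
      using eventually_at_right_less[of 0]
    proof eventually_elim
      case (elim \<epsilon>)
      have pos: "0 < sqrt t" "0 < sqrt t + \<epsilon>" if "t \<in> I" for t using sq[OF that] c elim by linarith+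
      have "\<bar>ln (sqrt t + \<epsilon>) - ln (sqrt t)\<bar> \<le> \<epsilon> / c" if "t \<in> I" for t
      proof -
        have "ln (sqrt t + \<epsilon>) - ln (sqrt t) \<le> (sqrt t + \<epsilon> - sqrt t) / sqrt t"
          by (rule ln_diff_le) (use pos[OF that] in auto)
        also have "\<dots> \<le> \<epsilon> / c" using sq[OF that] c elim by (simp add: frac_le)
        finally have "ln (sqrt t + \<epsilon>) - ln (sqrt t) \<le> \<epsilon> / c" .
        moreover have "ln (sqrt t) \<le> ln (sqrt t + \<epsilon>)" using pos[OF that] elim by simp
        ultimately show ?thesis by simp
      qed
      then show ?case
        unfolding real_norm_def using pos
        by (intro fun_trace_diff_le[OF HG sa H(2) I(1)] continuous_intros) force+
    qed
    show "((\<lambda>\<epsilon>. \<epsilon> / c) \<longlongrightarrow> 0) (at_right 0)"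
      using c by (auto intro!: tendsto_eq_intros)
  qed
  then have "((\<lambda>\<epsilon>. fun_trace H I (\<lambda>t. ln (sqrt t + \<epsilon>))) \<longlongrightarrow> fun_trace H I (\<lambda>t. ln (sqrt t))) (at_right 0)"
    by (rule LIM_zero_cancel)
  then show "((\<lambda>\<epsilon>. exp (fun_trace H I (\<lambda>t. ln (sqrt t + \<epsilon>)))) \<longlongrightarrow> exp (fun_trace H I (\<lambda>t. ln (sqrt t)))) (at_right 0)"
    by (rule tendsto_exp)
qed

end

text \<open>An \<epsilon>/3 argument: one polynomial approximates \<open>u\<close> on the common set
  \<open>I\<close>, and the Lipschitz bounds are uniform in \<open>n\<close>. The start
  \<open>N\<close> leaves room for the unconstrained index 0.\<close>

lemma tendsto_if_moments_tendsto:
  fixes \<Lambda> :: "(real \<Rightarrow> real) \<Rightarrow> real"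
  assumes I: "compact I" "continuous_on I u"
    and poly: "\<And>p. (\<lambda>n. \<Lambda>' n (poly p)) \<longlonglongrightarrow> \<Lambda> (poly p)"
    and lip: "\<And>p \<delta>. (\<And>t. t \<in> I \<Longrightarrow> \<bar>u t - poly p t\<bar> \<le> \<delta>) \<Longrightarrow> \<bar>\<Lambda> u - \<Lambda> (poly p)\<bar> \<le> \<delta>"
    and lip': "\<And>n p \<delta>. n \<ge> N \<Longrightarrow> (\<And>t. t \<in> I \<Longrightarrow> \<bar>u t - poly p t\<bar> \<le> \<delta>) \<Longrightarrow> \<bar>\<Lambda>' n u - \<Lambda>' n (poly p)\<bar> \<le> \<delta>"
  shows "(\<lambda>n. \<Lambda>' n u) \<longlonglongrightarrow> \<Lambda> u"
proof (rule tendstoI)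
  fix \<epsilon> :: real assume \<epsilon>: "\<epsilon> > 0"
  obtain g where g: "real_polynomial_function g" "\<And>t. t \<in> I \<Longrightarrow> \<bar>u t - g t\<bar> < \<epsilon> / 3"
    using Stone_Weierstrass_real_polynomial_function[OF I, of "\<epsilon> / 3"] \<epsilon> by auto
  obtain p where p: "g = poly p" using real_polynomial_function_poly[OF g(1)] .
  have ap: "\<bar>u t - poly p t\<bar> \<le> \<epsilon> / 3" if "t \<in> I" for t using g(2)[OF that] by (simp add: p)
  have "\<forall>\<^sub>F n in sequentially. dist (\<Lambda>' n (poly p)) (\<Lambda> (poly p)) < \<epsilon> / 3"
    using poly[of p] \<epsilon> by (intro tendstoD) auto
  then show "\<forall>\<^sub>F n in sequentially. dist (\<Lambda>' n u) (\<Lambda> u) < \<epsilon>"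
    using eventually_ge_at_top[of N]
  proof eventually_elim
    case (elim n)
    then show ?case using lip[OF ap] lip'[OF elim(2) ap] unfolding dist_real_def by linarith
  qed
qed

subsection \<open>The representation of the convolution algebra\<close>

no_notation Infinite_Set_Sum.abs_summable_on (infix "abs'_summable'_on" 50)

text \<open>A sum that does not exist has value 0, which the subspace contains; so
  \<open>L1_rep f\<close> lies in the algebra for every function \<open>f\<close>.\<close>

lemma infsum_in_closed_subspace:
  fixes f :: "'i \<Rightarrow> 'b::real_normed_vector"
  assumes "closed S" "subspace S" "\<And>i. i \<in> I \<Longrightarrow> f i \<in> S"
  shows "infsum f I \<in> S"
proof (cases "f summable_on I")
  case True
  then have lim: "(sum f \<longlongrightarrow> infsum f I) (finite_subsets_at_top I)"
    using has_sum_infsum by (auto simp: has_sum_def)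
  have "\<forall>\<^sub>F F in finite_subsets_at_top I. sum f F \<in> S"
    using assms by (intro eventually_finite_subsets_at_top_weakI) (auto intro!: subspace_sum)
  then show ?thesis using Lim_in_closed_set[OF assms(1) _ _ lim] by simp
next
  case False
  then show ?thesis using assms(2) by (simp add: infsum_not_exists subspace_0)
qed

text \<open>This is \<open>right_mult G (inv a)\<close>, the operator attached to \<open>a\<close>
  in \<open>L1_op\<close>. The inverse makes it multiplicative in \<open>a\<close> instead of
  order-reversing.\<close>

definition right_shift :: "('g, 'm) monoid_scheme \<Rightarrow> 'g \<Rightarrow> 'g ell2 \<Rightarrow>\<^sub>L 'g ell2" where
  "right_shift G a = comp_op (carrier G) (\<lambda>g. g \<otimes>\<^bsub>G\<^esub> a)"

definition weighted_shift :: "('g, 'm) monoid_scheme \<Rightarrow> 'g \<Rightarrow> complex \<Rightarrow> 'g ell2 \<Rightarrow>\<^sub>L 'g ell2" where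
  "weighted_shift G a c = scale_op c o\<^sub>L right_shift G a"

definition star :: "('g, 'm) monoid_scheme \<Rightarrow> ('g \<Rightarrow> complex) \<Rightarrow> 'g \<Rightarrow> complex" where
  "star G f = (\<lambda>a. if a \<in> carrier G then cnj (f (inv\<^bsub>G\<^esub> a)) else 0)"

definition l1_norm :: "('g, 'm) monoid_scheme \<Rightarrow> ('g \<Rightarrow> complex) \<Rightarrow> real" where
  "l1_norm G f = (\<Sum>\<^sub>\<infinity>a\<in>carrier G. norm (f a))"

lemma infsum_bounded_linear_apply:
  "bounded_linear L \<Longrightarrow> f summable_on I \<Longrightarrow> L (infsum f I) = (\<Sum>\<^sub>\<infinity>i\<in>I. L (f i))"
  by (metis has_sum_bounded_linear has_sum_infsum infsumI)

lemma L1_summable: "f \<in> Lp 1 G \<Longrightarrow> f abs_summable_on carrier G"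
  unfolding Lp_def by simp

lemma L1_I: "f abs_summable_on carrier G \<Longrightarrow> (\<And>g. g \<notin> carrier G \<Longrightarrow> f g = 0) \<Longrightarrow> f \<in> Lp 1 G"
  unfolding Lp_def by simp

context group
begin

lemma coeff2_right_shift:
  assumes "a \<in> carrier G"
  shows "coeff2 (right_shift G a x) g = (if g \<in> carrier G then coeff2 x (g \<otimes> a) else 0)"
proof -
  have "inj_on (\<lambda>g. g \<otimes> a) (carrier G)" using assms by (auto simp: inj_on_def)
  then show ?thesis by (simp add: right_shift_def coeff2_comp_op)
qed

lemma coeff2_weighted_shift [simp]:
  "a \<in> carrier G \<Longrightarrow> coeff2 (weighted_shift G a c x) g = (if g \<in> carrier G then c * coeff2 x (g \<otimes> a) else 0)"
  by (simp add: weighted_shift_def coeff2_right_shift)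

lemma norm_weighted_shift: "a \<in> carrier G \<Longrightarrow> norm (weighted_shift G a c) \<le> norm c"
proof -
  assume "a \<in> carrier G"
  then have "norm (right_shift G a) \<le> 1" unfolding right_shift_def by (intro norm_comp_op) (auto simp: inj_on_def)
  then have "norm (scale_op c :: 'a ell2 \<Rightarrow>\<^sub>L 'a ell2) * norm (right_shift G a) \<le> norm c * 1"
    by (intro mult_mono norm_scale_op) auto
  then show ?thesis unfolding weighted_shift_def using norm_blinfun_compose[of "scale_op c" "right_shift G a"] by linarith
qed

lemma weighted_shift_compose:
  "a \<in> carrier G \<Longrightarrow> b \<in> carrier G \<Longrightarrow> weighted_shift G a c o\<^sub>L weighted_shift G b d = weighted_shift G (a \<otimes> b) (c * d)"
  by (rule blinfun_ell2_eqI) (simp add: m_assoc)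

lemma weighted_shift_one: "weighted_shift G \<one> 1 = carrier_proj G"
  by (rule blinfun_ell2_eqI) simp

lemma weighted_shift_vN_blinfun: "a \<in> carrier G \<Longrightarrow> weighted_shift G a c \<in> vN_blinfun G"
  unfolding vN_blinfun_def by (auto intro!: blinfun_ell2_eqI simp: m_assoc)

lemma weighted_shift_adjoint:
  assumes "a \<in> carrier G"
  shows "weighted_shift G a c x \<bullet> y = x \<bullet> weighted_shift G (inv a) (cnj c) y"
proof -
  have "bij_betw (\<lambda>g. g \<otimes> a) (carrier G) (carrier G)"
    by (rule bij_betw_byWitness[of _ "\<lambda>g. g \<otimes> inv a"]) (use assms in \<open>auto simp: m_assoc\<close>)
  then have adj: "right_shift G a x \<bullet> y = x \<bullet> right_shift G (inv a) y" for x y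
    unfolding right_shift_def using assms by (intro comp_op_adjoint) (auto simp: m_assoc)
  have "right_shift G (inv a) o\<^sub>L scale_op (cnj c) = scale_op (cnj c) o\<^sub>L right_shift G (inv a)"
    using assms by (intro blinfun_ell2_eqI) (simp add: coeff2_right_shift)
  then have "right_shift G (inv a) (scale_op (cnj c) y) = scale_op (cnj c) (right_shift G (inv a) y)"
    by (metis blinfun_apply_blinfun_compose)
  then show ?thesis by (simp add: weighted_shift_def scale_op_adjoint adj)
qed

lemma weighted_shift_unit_vec: "a \<in> carrier G \<Longrightarrow> weighted_shift G a c unit_vec \<bullet> unit_vec = (if a = \<one> then Re c else 0)"
  by (simp add: inner_unit_vec coeff2_unit_vec delta_def)

lemma bounded_linear_weighted_shift: "a \<in> carrier G \<Longrightarrow> bounded_linear (weighted_shift G a)"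
  by (rule bounded_linear_intro[of _ 1])
     (auto intro!: blinfun_ell2_eqI simp: norm_weighted_shift blinfun.add_left blinfun.scaleR_left algebra_simps)

section \<open>The convolution algebra\<close>

lemma bij_left: "b \<in> carrier G \<Longrightarrow> bij_betw (\<lambda>a. b \<otimes> a) (carrier G) (carrier G)"
  by (rule bij_betw_byWitness[of _ "\<lambda>g. inv b \<otimes> g"]) (auto simp flip: m_assoc)

text \<open>Translation by \<open>b\<close> preserves the l1 norm of \<open>k\<close>, so the inner
  sums of norms are \<open>norm (f b) * l1_norm G k\<close>. Absolute summability on the product
  justifies the exchanges of sums for convolutions.\<close>

lemma convolution_summable:
  assumes f: "f \<in> Lp 1 G" and k: "k \<in> Lp 1 G"
  shows "(\<lambda>(b, g). f b * k (inv b \<otimes> g)) abs_summable_on carrier G \<times> carrier G"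
proof -
  have 1: "(\<lambda>g. norm (f b * k (inv b \<otimes> g))) summable_on carrier G \<and>
      (\<Sum>\<^sub>\<infinity>g\<in>carrier G. norm (f b * k (inv b \<otimes> g))) = norm (f b) * l1_norm G k"
    if b: "b \<in> carrier G" for b
  proof -
    have bij: "bij_betw (\<lambda>g. inv b \<otimes> g) (carrier G) (carrier G)" using b by (intro bij_left) simp
    have "(\<lambda>g. norm (k (inv b \<otimes> g))) summable_on carrier G"
      using L1_summable[OF k] summable_on_reindex_bij_betw[OF bij, of "\<lambda>g. norm (k g)"] by simp
    moreover have "(\<Sum>\<^sub>\<infinity>g\<in>carrier G. norm (k (inv b \<otimes> g))) = l1_norm G k"
      unfolding l1_norm_def using infsum_reindex_bij_betw[OF bij, of "\<lambda>g. norm (k g)"] by simp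
    ultimately show ?thesis
      by (simp add: norm_mult infsum_cmult_right' summable_on_cmult_right)
  qed
  have "(\<lambda>b. norm (f b) * l1_norm G k) summable_on carrier G"
    by (intro summable_on_cmult_left L1_summable f)
  moreover have "0 \<le> l1_norm G k" unfolding l1_norm_def by (rule infsum_nonneg) simp
  ultimately have "(\<lambda>b. \<Sum>\<^sub>\<infinity>g\<in>carrier G. norm (f b * k (inv b \<otimes> g))) abs_summable_on carrier G"
    using 1 by (simp add: abs_mult cong: summable_on_cong)
  then show ?thesis using 1 by (simp add: Infinite_Sum.abs_summable_on_Sigma_iff)
qed

lemma convolution_L1:
  assumes f: "f \<in> Lp 1 G" and k: "k \<in> Lp 1 G"
  shows "convolution G f k \<in> Lp 1 G"
proof -
  have "(\<lambda>(g, b). f b * k (inv b \<otimes> g)) abs_summable_on carrier G \<times> carrier G"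
    using summable_on_swap[THEN iffD1, OF convolution_summable[OF assms]]
    by (simp add: case_prod_unfold)
  then have inner: "\<And>g. g \<in> carrier G \<Longrightarrow> (\<lambda>b. f b * k (inv b \<otimes> g)) abs_summable_on carrier G"
    and outer: "(\<lambda>g. \<Sum>\<^sub>\<infinity>b\<in>carrier G. norm (f b * k (inv b \<otimes> g))) abs_summable_on carrier G"
    by (auto simp: Infinite_Sum.abs_summable_on_Sigma_iff)
  have "(\<lambda>g. norm (convolution G f k g)) summable_on carrier G"
  proof (rule Infinite_Sum.abs_summable_on_comparison_test[OF outer])
    fix g assume g: "g \<in> carrier G"
    then have "norm (convolution G f k g) \<le> (\<Sum>\<^sub>\<infinity>b\<in>carrier G. norm (f b * k (inv b \<otimes> g)))"
      by (simp add: convolution_def norm_infsum_bound[OF inner[OF g]])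
    then show "norm (convolution G f k g) \<le> norm (\<Sum>\<^sub>\<infinity>b\<in>carrier G. norm (f b * k (inv b \<otimes> g)))"
      by simp
  qed
  then show ?thesis by (intro L1_I) (auto simp: convolution_def)
qed

lemma delta_L1: "delta \<one> \<in> Lp 1 G"
  by (rule L1_I) (auto simp: delta_def intro!: finite_nonzero_values_imp_summable_on intro: finite_subset[of _ "{\<one>}"])

lemma bij_inv: "bij_betw (\<lambda>a. inv a) (carrier G) (carrier G)"
  by (rule bij_betw_byWitness[of _ "\<lambda>a. inv a"]) auto

lemma star_L1: "f \<in> Lp 1 G \<Longrightarrow> star G f \<in> Lp 1 G"
  using summable_on_reindex_bij_betw[OF bij_inv, of "\<lambda>a. norm (f a)"] L1_summable[of f G]
  by (intro L1_I) (auto simp: star_def cong: summable_on_cong)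

end

section \<open>The representation induced by a homomorphism\<close>

context group_hom
begin

text \<open>The homomorphism \<open>h\<close> turns the right translations of \<open>H\<close> into a unitary representation of
  \<open>G\<close>, which integrates to \<open>L\<^sup>1(G)\<close>.\<close>

definition L1_rep :: "('a \<Rightarrow> complex) \<Rightarrow> 'c ell2 \<Rightarrow>\<^sub>L 'c ell2" where
  "L1_rep f = (\<Sum>\<^sub>\<infinity>a\<in>carrier G. weighted_shift H (h a) (f a))"

lemma weighted_shift_abs_summable:
  assumes "f abs_summable_on S" "S \<subseteq> carrier G"
  shows "(\<lambda>a. weighted_shift H (h a) (f a)) abs_summable_on S"
  by (rule Infinite_Sum.abs_summable_on_comparison_test[OF assms(1)]) (use assms(2) H.norm_weighted_shift hom_closed in blast)

lemma L1_rep_summable: "f \<in> Lp 1 G \<Longrightarrow> (\<lambda>a. weighted_shift H (h a) (f a)) summable_on carrier G"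
  by (rule abs_summable_summable[OF weighted_shift_abs_summable[OF L1_summable order_refl]])

lemma L1_rep_vN_blinfun: "L1_rep f \<in> vN_blinfun H"
  unfolding L1_rep_def
  by (intro infsum_in_closed_subspace H.vN.closed_A H.vN.subspace_A) (simp add: H.weighted_shift_vN_blinfun)

lemma norm_L1_rep:
  assumes "f \<in> Lp 1 G" shows "norm (L1_rep f) \<le> l1_norm G f"
proof -
  note f = L1_summable[OF assms]
  have "norm (L1_rep f) \<le> (\<Sum>\<^sub>\<infinity>a\<in>carrier G. norm (weighted_shift H (h a) (f a)))"
    unfolding L1_rep_def by (rule norm_infsum_bound[OF weighted_shift_abs_summable[OF f order_refl]])
  also have "\<dots> \<le> l1_norm G f"
    unfolding l1_norm_def using H.norm_weighted_shift by (intro infsum_mono weighted_shift_abs_summable f) auto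
  finally show ?thesis .
qed

lemma L1_rep_linear:
  assumes f: "f \<in> Lp 1 G" and L: "bounded_linear L"
  shows "L (L1_rep f) = (\<Sum>\<^sub>\<infinity>a\<in>carrier G. L (weighted_shift H (h a) (f a)))"
  unfolding L1_rep_def by (rule infsum_bounded_linear_apply[OF L L1_rep_summable[OF f]])

text \<open>The double sum is exchanged and g = b a is substituted in the inner sum; then
  \<open>weighted_shift_compose\<close> separates the factors.\<close>

lemma L1_rep_convolution:
  assumes f: "f \<in> Lp 1 G" and k: "k \<in> Lp 1 G"
  shows "L1_rep (convolution G f k) = L1_rep f o\<^sub>L L1_rep k"
proof -
  let ?F = "\<lambda>b g. weighted_shift H (h g) (f b * k (inv b \<otimes> g))"
  have sum: "(\<lambda>(b, g). f b * k (inv b \<otimes> g)) abs_summable_on carrier G \<times> carrier G"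
    by (rule G.convolution_summable[OF f k])
  have swp: "(\<lambda>(g, b). f b * k (inv b \<otimes> g)) abs_summable_on carrier G \<times> carrier G"
    using summable_on_swap[THEN iffD1, OF sum] by (simp add: case_prod_unfold)
  have in1: "(\<lambda>b. f b * k (inv b \<otimes> g)) summable_on carrier G" if "g \<in> carrier G" for g
    using swp that by (auto simp: Infinite_Sum.abs_summable_on_Sigma_iff intro: abs_summable_summable)
  have "(\<lambda>(b, g). ?F b g) abs_summable_on carrier G \<times> carrier G"
    by (rule Infinite_Sum.abs_summable_on_comparison_test[OF sum]) (auto intro!: H.norm_weighted_shift)
  then have F: "(\<lambda>(b, g). ?F b g) summable_on carrier G \<times> carrier G"
    by (rule abs_summable_summable)
  have "L1_rep (convolution G f k) = (\<Sum>\<^sub>\<infinity>g\<in>carrier G. \<Sum>\<^sub>\<infinity>b\<in>carrier G. ?F b g)"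
    unfolding L1_rep_def
  proof (rule infsum_cong)
    fix g assume g: "g \<in> carrier G"
    then show "weighted_shift H (h g) (convolution G f k g) = (\<Sum>\<^sub>\<infinity>b\<in>carrier G. ?F b g)"
      using infsum_bounded_linear_apply[OF H.bounded_linear_weighted_shift[OF hom_closed[OF g]] in1[OF g]]
      by (simp add: convolution_def)
  qed
  also have "\<dots> = (\<Sum>\<^sub>\<infinity>b\<in>carrier G. \<Sum>\<^sub>\<infinity>g\<in>carrier G. ?F b g)"
    by (rule infsum_swap_banach[OF F, symmetric])
  also have "\<dots> = (\<Sum>\<^sub>\<infinity>b\<in>carrier G. weighted_shift H (h b) (f b) o\<^sub>L L1_rep k)"
  proof (rule infsum_cong)
    fix b assume b: "b \<in> carrier G"
    have "(\<Sum>\<^sub>\<infinity>g\<in>carrier G. ?F b g) = (\<Sum>\<^sub>\<infinity>a\<in>carrier G. ?F b (b \<otimes> a))"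
      by (rule infsum_reindex_bij_betw[OF G.bij_left[OF b], symmetric])
    also have "\<dots> = (\<Sum>\<^sub>\<infinity>a\<in>carrier G. weighted_shift H (h b) (f b) o\<^sub>L weighted_shift H (h a) (k a))"
    proof (rule infsum_cong)
      fix a assume a: "a \<in> carrier G"
      then have "inv b \<otimes> (b \<otimes> a) = a" using b by (simp flip: G.m_assoc)
      then show "?F b (b \<otimes> a) = weighted_shift H (h b) (f b) o\<^sub>L weighted_shift H (h a) (k a)"
        using a b by (simp add: H.weighted_shift_compose)
    qed
    also have "\<dots> = weighted_shift H (h b) (f b) o\<^sub>L L1_rep k"
      by (rule L1_rep_linear[OF k blinfun_compose.bounded_linear_right, symmetric])
    finally show "(\<Sum>\<^sub>\<infinity>g\<in>carrier G. ?F b g) = weighted_shift H (h b) (f b) o\<^sub>L L1_rep k" .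
  qed
  also have "\<dots> = L1_rep f o\<^sub>L L1_rep k"
    by (rule L1_rep_linear[OF f blinfun_compose.bounded_linear_left, symmetric])
  finally show ?thesis .
qed

lemma L1_rep_delta: "L1_rep (delta \<one>) = carrier_proj H"
proof -
  have "L1_rep (delta \<one>) = (\<Sum>\<^sub>\<infinity>a\<in>{\<one>}. weighted_shift H (h a) (delta \<one> a))"
    unfolding L1_rep_def
    by (intro infsum_cong_neutral)
       (auto simp: delta_def linear_0[OF bounded_linear.linear[OF H.bounded_linear_weighted_shift]])
  then show ?thesis by (simp add: delta_def H.weighted_shift_one)
qed

text \<open>The adjoint of the translation by \<open>h a\<close> is the translation by its inverse;
  reindexing by inversion produces \<open>star\<close>.\<close>

lemma L1_rep_star:
  assumes f: "f \<in> Lp 1 G"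
  shows "L1_rep f x \<bullet> y = x \<bullet> L1_rep (star G f) y"
proof -
  have L: "bounded_linear (\<lambda>T. blinfun_apply T x \<bullet> y)" and R: "bounded_linear (\<lambda>T. x \<bullet> blinfun_apply T y)" for x y :: "'c ell2"
    by (intro bounded_linear_intros)+
  have "L1_rep f x \<bullet> y = (\<Sum>\<^sub>\<infinity>a\<in>carrier G. weighted_shift H (h a) (f a) x \<bullet> y)"
    by (rule L1_rep_linear[OF f L])
  also have "\<dots> = (\<Sum>\<^sub>\<infinity>a\<in>carrier G. x \<bullet> weighted_shift H (h (inv a)) (star G f (inv a)) y)"
    by (intro infsum_cong) (simp add: H.weighted_shift_adjoint star_def hom_inv)
  also have "\<dots> = (\<Sum>\<^sub>\<infinity>a\<in>carrier G. x \<bullet> weighted_shift H (h a) (star G f a) y)"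
    by (rule infsum_reindex_bij_betw[OF G.bij_inv, of "\<lambda>a. x \<bullet> weighted_shift H (h a) (star G f a) y"])
  also have "\<dots> = x \<bullet> L1_rep (star G f) y"
    by (rule L1_rep_linear[OF G.star_L1[OF f] R, symmetric])
  finally show ?thesis .
qed

text \<open>Translation by \<open>h a\<close> moves the unit vector to an orthogonal one unless
  \<open>h a\<close> is the unit. This is where the kernel enters.\<close>

lemma L1_rep_trace:
  assumes f: "f \<in> Lp 1 G"
  shows "L1_rep f H.unit_vec \<bullet> H.unit_vec = (\<Sum>\<^sub>\<infinity>a\<in>kernel G H h. Re (f a))"
proof -
  have L: "bounded_linear (\<lambda>T. blinfun_apply T H.unit_vec \<bullet> H.unit_vec)"
    by (intro bounded_linear_intros)
  have "L1_rep f H.unit_vec \<bullet> H.unit_vec = (\<Sum>\<^sub>\<infinity>a\<in>carrier G. weighted_shift H (h a) (f a) H.unit_vec \<bullet> H.unit_vec)"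
    by (rule L1_rep_linear[OF f L])
  also have "\<dots> = (\<Sum>\<^sub>\<infinity>a\<in>kernel G H h. Re (f a))"
    by (intro infsum_cong_neutral) (auto simp: H.weighted_shift_unit_vec kernel_def)
  finally show ?thesis .
qed

text \<open>Grouping the sum over \<open>carrier G\<close> by the fibres of \<open>h\<close> turns
  the coefficients of \<open>f\<close> into those of the pushforward. The operator on the target
  group can thus be studied through \<open>f\<close> alone.\<close>

lemma L1_op_pushforward:
  assumes f: "f \<in> Lp 1 G"
  shows "L1_op H (pushforward G h f) = as_op H (L1_rep f)"
  unfolding L1_op_def
proof (rule H.as_op_eqI, rule ext)
  fix X :: "'c ell2" and g :: 'c
  assume X: "carrier_proj H X = X"
  let ?fib = "\<lambda>b. {a \<in> carrier G. h a = b}"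
  have L: "bounded_linear (\<lambda>T. coeff2 (blinfun_apply T X) g)"
    using bounded_linear_compose[OF bounded_linear_coeff2 blinfun.bounded_linear_left] .
  have R: "coeff2 (L1_rep f X) g = (\<Sum>\<^sub>\<infinity>a\<in>carrier G. coeff2 (weighted_shift H (h a) (f a) X) g)"
    by (rule L1_rep_linear[OF f L])
  show "(\<Sum>\<^sub>\<infinity>b\<in>carrier H. pushforward G h f b * right_mult H (inv\<^bsub>H\<^esub> b) (coeff2 X) g) = coeff2 (L1_rep f X) g"
  proof (cases "g \<in> carrier H")
    case False
    then show ?thesis unfolding R by (simp add: right_mult_def cong: infsum_cong)
  next
    case True
    let ?F = "\<lambda>b a. f a * coeff2 X (g \<otimes>\<^bsub>H\<^esub> b)"
    have "(\<lambda>a. norm (f a) * norm X) summable_on carrier G"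
      by (intro summable_on_cmult_left L1_summable f)
    then have "(\<lambda>a. norm (?F (h a) a)) summable_on carrier G"
      by (rule summable_on_comparison_test) (auto simp: norm_mult intro!: mult_left_mono norm_coeff2_le)
    then have s: "(\<lambda>a. ?F (h a) a) summable_on carrier G" by (rule abs_summable_summable)
    have bij: "bij_betw (\<lambda>a. (h a, a)) (carrier G) (Sigma (carrier H) ?fib)"
      by (rule bij_betw_byWitness[of _ snd]) auto
    have S: "(\<lambda>(b, a). ?F b a) summable_on Sigma (carrier H) ?fib"
      using s summable_on_reindex_bij_betw[OF bij, of "\<lambda>(b, a). ?F b a"] by simp
    have "(\<Sum>\<^sub>\<infinity>b\<in>carrier H. pushforward G h f b * right_mult H (inv\<^bsub>H\<^esub> b) (coeff2 X) g) =
        (\<Sum>\<^sub>\<infinity>b\<in>carrier H. \<Sum>\<^sub>\<infinity>a\<in>?fib b. ?F b a)"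
      using True by (intro infsum_cong) (simp add: pushforward_def right_mult_def infsum_cmult_left')
    also have "\<dots> = (\<Sum>\<^sub>\<infinity>(b, a)\<in>Sigma (carrier H) ?fib. ?F b a)"
      by (rule infsum_Sigma'_banach[OF S])
    also have "\<dots> = (\<Sum>\<^sub>\<infinity>a\<in>carrier G. ?F (h a) a)"
      using infsum_reindex_bij_betw[OF bij, of "\<lambda>(b, a). ?F b a"] by simp
    also have "\<dots> = coeff2 (L1_rep f X) g"
      unfolding R using True by (intro infsum_cong) simp
    finally show ?thesis .
  qed
qed

end

section \<open>Convolution powers and sums over shrinking subgroups\<close>

context group
begin

primrec conv_pow :: "('a \<Rightarrow> complex) \<Rightarrow> nat \<Rightarrow> 'a \<Rightarrow> complex" where
  "conv_pow x 0 = delta \<one>"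
| "conv_pow x (Suc n) = convolution G x (conv_pow x n)"

lemma conv_pow_L1: "x \<in> Lp 1 G \<Longrightarrow> conv_pow x n \<in> Lp 1 G"
  by (induction n) (auto simp del: One_nat_def intro: delta_L1 convolution_L1)

definition sq_abs :: "('a \<Rightarrow> complex) \<Rightarrow> 'a \<Rightarrow> complex" where
  "sq_abs f = convolution G (star G f) f"

lemma sq_abs_L1: "f \<in> Lp 1 G \<Longrightarrow> sq_abs f \<in> Lp 1 G"
  unfolding sq_abs_def by (intro convolution_L1 star_L1)

text \<open>All but a small part of the absolutely convergent sum sits on a finite \<open>F\<close>.
  Once \<open>K n\<close> meets \<open>F\<close> at most in the unit, the sum over
  \<open>K n\<close> differs from the value at the unit by at most the tail.\<close>

lemma infsum_subgroups_tendsto: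
  fixes y :: "'a \<Rightarrow> real"
  assumes y: "y abs_summable_on carrier G" and K: "subgroups_tend_to_one G K"
    and sub: "\<And>n. n \<ge> 1 \<Longrightarrow> K n \<subseteq> carrier G \<and> \<one> \<in> K n"
  shows "(\<lambda>n. \<Sum>\<^sub>\<infinity>a\<in>K n. y a) \<longlonglongrightarrow> y \<one>"
proof (rule tendstoI)
  fix \<epsilon> :: real assume \<epsilon>: "\<epsilon> > 0"
  obtain F where F: "finite F" "F \<subseteq> carrier G"
    "dist (\<Sum>a\<in>F. norm (y a)) (\<Sum>\<^sub>\<infinity>a\<in>carrier G. norm (y a)) \<le> \<epsilon> / 2"
    using infsum_finite_approximation[OF y, of "\<epsilon> / 2"] \<epsilon> by auto
  have "(\<Sum>\<^sub>\<infinity>a\<in>carrier G - F. norm (y a)) = (\<Sum>\<^sub>\<infinity>a\<in>carrier G. norm (y a)) - (\<Sum>a\<in>F. norm (y a))"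
    using F by (subst infsum_Diff[OF y]) auto
  then have tail: "(\<Sum>\<^sub>\<infinity>a\<in>carrier G - F. norm (y a)) < \<epsilon>"
    using F(3) \<epsilon> unfolding dist_real_def by linarith
  \<comment> \<open>The guard on \<open>n\<close> mirrors \<open>subgroups_tend_to_one\<close>,
    which speaks only of indices from 1 on.\<close>
  have "\<forall>\<^sub>F n in sequentially. \<forall>g\<in>F - {\<one>}. n \<ge> 1 \<longrightarrow> g \<notin> K n"
  proof (rule eventually_ball_finite)
    show "\<forall>g\<in>F - {\<one>}. \<forall>\<^sub>F n in sequentially. n \<ge> 1 \<longrightarrow> g \<notin> K n"
    proof
      fix g assume g: "g \<in> F - {\<one>}"
      then have "g \<notin> {g \<in> carrier G. infinite {n. n \<ge> 1 \<and> g \<in> K n}}"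
        using K by (simp add: subgroups_tend_to_one_def)
      then have "finite {n. n \<ge> 1 \<and> g \<in> K n}" using g F(2) by auto
      then show "\<forall>\<^sub>F n in sequentially. n \<ge> 1 \<longrightarrow> g \<notin> K n"
        by (simp add: eventually_cofinite flip: cofinite_eq_sequentially)
    qed
  qed (use F in auto)
  then show "\<forall>\<^sub>F n in sequentially. dist (\<Sum>\<^sub>\<infinity>a\<in>K n. y a) (y \<one>) < \<epsilon>"
    using eventually_ge_at_top[of 1]
  proof eventually_elim
    case (elim n)
    have Kn: "K n \<subseteq> carrier G" "\<one> \<in> K n" using sub elim by auto
    have s: "y abs_summable_on S" if "S \<subseteq> carrier G" for S
      using summable_on_subset_banach[OF y that] .
    have sK: "y abs_summable_on K n - {\<one>}" using Kn by (intro s) auto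
    have "(\<Sum>\<^sub>\<infinity>a\<in>K n. y a) = y \<one> + (\<Sum>\<^sub>\<infinity>a\<in>K n - {\<one>}. y a)"
      using infsum_insert[OF abs_summable_summable[OF sK], of \<one>] Kn(2) by (simp add: insert_absorb)
    then have "dist (\<Sum>\<^sub>\<infinity>a\<in>K n. y a) (y \<one>) = norm (\<Sum>\<^sub>\<infinity>a\<in>K n - {\<one>}. y a)"
      by (simp add: dist_norm)
    also have "\<dots> \<le> (\<Sum>\<^sub>\<infinity>a\<in>K n - {\<one>}. norm (y a))" by (rule norm_infsum_bound[OF sK])
    also have "\<dots> \<le> (\<Sum>\<^sub>\<infinity>a\<in>carrier G - F. norm (y a))"
    proof (rule infsum_mono2[OF sK])
      show "y abs_summable_on carrier G - F" by (rule s) blast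
      show "K n - {\<one>} \<subseteq> carrier G - F" using elim Kn by blast
    qed simp
    finally show ?case using tail by simp
  qed
qed

end

lemma l1_norm_nonneg: "0 \<le> l1_norm G f"
  unfolding l1_norm_def by (rule infsum_nonneg) simp

section \<open>Spectral bounds and determinants of the represented elements\<close>

context group_hom
begin

lemma L1_rep_conv_pow: "x \<in> Lp 1 G \<Longrightarrow> L1_rep (G.conv_pow x n) = H.vN.power_op (L1_rep x) n"
  by (induction n) (simp_all add: L1_rep_delta L1_rep_convolution G.conv_pow_L1 del: One_nat_def)

lemma L1_rep_sq_abs: "f \<in> Lp 1 G \<Longrightarrow> L1_rep (G.sq_abs f) = L1_rep (star G f) o\<^sub>L L1_rep f"
  by (simp add: G.sq_abs_def L1_rep_convolution G.star_L1 del: One_nat_def)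

lemma selfadj_sq_abs: "f \<in> Lp 1 G \<Longrightarrow> selfadj (L1_rep (G.sq_abs f))"
  unfolding L1_rep_sq_abs selfadj_def blinfun_apply_blinfun_compose
  using L1_rep_star by (metis inner_commute)

text \<open>The quadratic form at \<open>x\<close> is \<open>(norm (L1_rep f x))\<^sup>2\<close>, so
  norm bounds for \<open>f\<close> become bounds for the spectrum. The upper end depends on
  \<open>f\<close> only, not on the homomorphism.\<close>

lemma real_spectrum_sq_abs:
  assumes f: "f \<in> Lp 1 G" and c: "c \<ge> 0" "\<And>x. c * norm (carrier_proj H x) \<le> norm (L1_rep f x)"
  shows "H.vN.real_spectrum (L1_rep (G.sq_abs f)) \<subseteq> {c\<^sup>2..(l1_norm G f)\<^sup>2}"
proof (rule H.vN.real_spectrum_subset_Icc[OF L1_rep_vN_blinfun selfadj_sq_abs[OF f]])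
  fix x
  have eq: "L1_rep (G.sq_abs f) x \<bullet> x = (norm (L1_rep f x))\<^sup>2"
    using L1_rep_star[OF f, of x "L1_rep f x"]
    by (simp add: L1_rep_sq_abs[OF f] power2_norm_eq_inner inner_commute)
  show "c\<^sup>2 * (norm (carrier_proj H x))\<^sup>2 \<le> L1_rep (G.sq_abs f) x \<bullet> x"
    unfolding eq power_mult_distrib[symmetric] using c by (intro power_mono) auto
  have "norm (L1_rep f x) \<le> norm (L1_rep f) * norm (carrier_proj H x)"
    by (metis H.vN_blinfun_apply(2) norm_blinfun L1_rep_vN_blinfun)
  also have "\<dots> \<le> l1_norm G f * norm (carrier_proj H x)" by (intro mult_right_mono norm_L1_rep[OF f]) auto
  finally show "L1_rep (G.sq_abs f) x \<bullet> x \<le> (l1_norm G f)\<^sup>2 * (norm (carrier_proj H x))\<^sup>2"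
    unfolding eq power_mult_distrib[symmetric] by (intro power_mono) auto
qed

lemma real_spectrum_sq_abs_0:
  "f \<in> Lp 1 G \<Longrightarrow> H.vN.real_spectrum (L1_rep (G.sq_abs f)) \<subseteq> {0..(l1_norm G f)\<^sup>2}"
  using real_spectrum_sq_abs[of f 0] by simp

text \<open>The integral of \<open>u\<close> against the spectral measure of \<open>f\<^sup>* f\<close>.\<close>

definition spectral_integral :: "('a \<Rightarrow> complex) \<Rightarrow> real set \<Rightarrow> (real \<Rightarrow> real) \<Rightarrow> real" where
  "spectral_integral f I u = H.fun_trace (L1_rep (G.sq_abs f)) I u"

context
  fixes f I
  assumes f: "f \<in> Lp 1 G" and real_spectrum: "H.vN.real_spectrum (L1_rep (G.sq_abs f)) \<subseteq> I" and I: "compact I"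
begin

lemma spectral_integral_poly:
  "spectral_integral f I (poly p) =
    (\<Sum>i\<le>degree p. coeff p i * (\<Sum>\<^sub>\<infinity>a\<in>kernel G H h. Re (G.conv_pow (G.sq_abs f) i a)))"
  unfolding spectral_integral_def
  using f by (simp add: H.fun_trace_poly[OF L1_rep_vN_blinfun selfadj_sq_abs real_spectrum I] H.vN.poly_op_eq_sum blinfun.sum_left
      blinfun.scaleR_left inner_sum_left G.sq_abs_L1 G.conv_pow_L1 flip: L1_rep_conv_pow L1_rep_trace del: One_nat_def)

lemma spectral_integral_diff_le:
  assumes "continuous_on I u" "\<And>t. t \<in> I \<Longrightarrow> \<bar>u t - poly p t\<bar> \<le> \<delta>"
  shows "\<bar>spectral_integral f I u - spectral_integral f I (poly p)\<bar> \<le> \<delta>"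
  unfolding spectral_integral_def
  by (intro H.fun_trace_diff_le[OF L1_rep_vN_blinfun selfadj_sq_abs[OF f] real_spectrum I] assms continuous_intros)

lemma fk_det_le_spectral_integral:
  assumes "I \<subseteq> {0..}" "\<epsilon> > 0"
  shows "fk_det H (L1_op H (pushforward G h f)) \<le> exp (spectral_integral f I (\<lambda>t. ln (sqrt t + \<epsilon>)))"
  unfolding L1_op_pushforward[OF f] spectral_integral_def
  by (rule H.fk_det_as_op(1)[OF L1_rep_vN_blinfun L1_rep_vN_blinfun L1_rep_star[OF f] L1_rep_sq_abs[OF f] real_spectrum I assms])

lemma fk_det_tendsto_spectral_integral:
  assumes "I \<subseteq> {0..}"
  shows "((\<lambda>\<epsilon>. exp (spectral_integral f I (\<lambda>t. ln (sqrt t + \<epsilon>)))) \<longlongrightarrow>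
    fk_det H (L1_op H (pushforward G h f))) (at_right 0)"
  unfolding L1_op_pushforward[OF f] spectral_integral_def
  by (rule H.fk_det_as_op(2)[OF L1_rep_vN_blinfun L1_rep_vN_blinfun L1_rep_star[OF f] L1_rep_sq_abs[OF f] real_spectrum I assms])

lemma fk_det_eq_spectral_integral:
  assumes "I \<subseteq> {c\<^sup>2..}" "c > 0"
  shows "fk_det H (L1_op H (pushforward G h f)) = exp (spectral_integral f I (\<lambda>t. ln (sqrt t)))"
  unfolding L1_op_pushforward[OF f] spectral_integral_def
  by (rule H.fk_det_bounded_below[OF L1_rep_vN_blinfun L1_rep_vN_blinfun L1_rep_star[OF f] L1_rep_sq_abs[OF f] real_spectrum I assms])

end

text \<open>The lower bound does not depend on \<open>h\<close>.\<close>

lemma real_spectrum_sq_abs_unit: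
  assumes f: "f \<in> Lp 1 G" and k: "k \<in> Lp 1 G" "convolution G k f = delta \<one>"
  shows "H.vN.real_spectrum (L1_rep (G.sq_abs f)) \<subseteq> {(inverse (l1_norm G k))\<^sup>2..(l1_norm G f)\<^sup>2}"
    and "l1_norm G k > 0"
proof -
  have inv: "L1_rep k o\<^sub>L L1_rep f = carrier_proj H"
    using L1_rep_convolution[OF k(1) f] by (simp add: k(2) L1_rep_delta)
  have "l1_norm G k \<noteq> 0"
  proof
    assume "l1_norm G k = 0"
    then have "L1_rep k = 0" using norm_L1_rep[OF k(1)] by simp
    then show False using inv H.vN.unit_nonzero by simp
  qed
  then show pos: "l1_norm G k > 0" using l1_norm_nonneg[of G k] by simp
  show "H.vN.real_spectrum (L1_rep (G.sq_abs f)) \<subseteq> {(inverse (l1_norm G k))\<^sup>2..(l1_norm G f)\<^sup>2}"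
  proof (rule real_spectrum_sq_abs[OF f])
    fix x
    have "norm (carrier_proj H x) \<le> norm (L1_rep k) * norm (L1_rep f x)"
      using norm_blinfun[of "L1_rep k" "L1_rep f x"] by (simp flip: inv)
    also have "\<dots> \<le> l1_norm G k * norm (L1_rep f x)" by (intro mult_right_mono norm_L1_rep[OF k(1)]) auto
    finally show "inverse (l1_norm G k) * norm (carrier_proj H x) \<le> norm (L1_rep f x)"
      using pos by (simp add: field_simps)
  qed (use pos in simp)
qed

end

text \<open>The original group is treated as the target of its identity homomorphism, so the results
  on \<open>group_hom\<close> cover both sides of the comparison.\<close>

lemma pushforward_id:
  assumes "f \<in> Lp 1 G" shows "pushforward G (\<lambda>x. x) f = f"
proof
  fix b
  show "pushforward G (\<lambda>x. x) f b = f b"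
  proof (cases "b \<in> carrier G")
    case True
    then have "{g \<in> carrier G. g = b} = {b}" by auto
    then show ?thesis by (simp add: pushforward_def)
  next
    case False
    then have "{g \<in> carrier G. g = b} = {}" by auto
    then show ?thesis using False assms by (simp add: pushforward_def Lp_def)
  qed
qed

subsection \<open>Convergence\<close>

text \<open>The set \<open>I\<close> stays a parameter so that the lemma serves both claims: with an
  interval starting at 0 in general, and with one bounded away from 0 for units. Locale constants
  carry explicit arguments because the target group varies with \<open>n\<close>.\<close>

lemma spectral_integral_tendsto:
  fixes \<Gamma> :: "('g, 'm) monoid_scheme" and \<Gamma>' :: "nat \<Rightarrow> ('h, 'k) monoid_scheme"
  assumes \<Gamma>: "group \<Gamma>" and hom: "\<And>n. n \<ge> 1 \<Longrightarrow> group_hom \<Gamma> (\<Gamma>' n) (\<phi> n)"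
    and K: "subgroups_tend_to_one \<Gamma> (\<lambda>n. kernel \<Gamma> (\<Gamma>' n) (\<phi> n))"
    and f: "f \<in> Lp 1 \<Gamma>" and I: "compact I" "continuous_on I u"
    and real_spectrum: "\<And>n. n \<ge> 1 \<Longrightarrow> op_algebra.real_spectrum (vN_blinfun (\<Gamma>' n)) (carrier_proj (\<Gamma>' n))
      (group_hom.L1_rep \<Gamma> (\<Gamma>' n) (\<phi> n) (group.sq_abs \<Gamma> f)) \<subseteq> I"
    and real_spectrum_id: "op_algebra.real_spectrum (vN_blinfun \<Gamma>) (carrier_proj \<Gamma>) (group_hom.L1_rep \<Gamma> \<Gamma> (\<lambda>x. x) (group.sq_abs \<Gamma> f)) \<subseteq> I"
  shows "(\<lambda>n. group_hom.spectral_integral \<Gamma> (\<Gamma>' n) (\<phi> n) f I u)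
    \<longlonglongrightarrow> group_hom.spectral_integral \<Gamma> \<Gamma> (\<lambda>x. x) f I u"
proof -
  interpret \<Gamma>: group \<Gamma> by fact
  have id: "group_hom \<Gamma> \<Gamma> (\<lambda>x. x)" by unfold_locales (auto simp: hom_def)
  show ?thesis
  proof (rule tendsto_if_moments_tendsto[OF I, where N = 1])
    fix p :: "real poly"
    let ?s = "\<lambda>S. \<Sum>i\<le>degree p. coeff p i * (\<Sum>\<^sub>\<infinity>a\<in>S. Re (\<Gamma>.conv_pow (\<Gamma>.sq_abs f) i a))"
    have "(\<lambda>n. \<Sum>\<^sub>\<infinity>a\<in>kernel \<Gamma> (\<Gamma>' n) (\<phi> n). Re (\<Gamma>.conv_pow (\<Gamma>.sq_abs f) i a))
        \<longlonglongrightarrow> Re (\<Gamma>.conv_pow (\<Gamma>.sq_abs f) i \<one>\<^bsub>\<Gamma>\<^esub>)" for i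
    proof (rule \<Gamma>.infsum_subgroups_tendsto[OF _ K])
      have "(\<lambda>a. \<Gamma>.conv_pow (\<Gamma>.sq_abs f) i a) abs_summable_on carrier \<Gamma>"
        by (intro L1_summable \<Gamma>.conv_pow_L1 \<Gamma>.sq_abs_L1 f)
      then show "(\<lambda>a. Re (\<Gamma>.conv_pow (\<Gamma>.sq_abs f) i a)) abs_summable_on carrier \<Gamma>"
        by (rule Infinite_Sum.abs_summable_on_comparison_test) (simp add: abs_Re_le_cmod)
      show "kernel \<Gamma> (\<Gamma>' n) (\<phi> n) \<subseteq> carrier \<Gamma> \<and> \<one>\<^bsub>\<Gamma>\<^esub> \<in> kernel \<Gamma> (\<Gamma>' n) (\<phi> n)" if "n \<ge> 1" for n
        using group_hom.hom_one[OF hom[OF that]] by (auto simp: kernel_def)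
    qed
    then have lim: "(\<lambda>n. ?s (kernel \<Gamma> (\<Gamma>' n) (\<phi> n))) \<longlonglongrightarrow>
        (\<Sum>i\<le>degree p. coeff p i * Re (\<Gamma>.conv_pow (\<Gamma>.sq_abs f) i \<one>\<^bsub>\<Gamma>\<^esub>))"
      by (intro tendsto_intros)
    \<comment> \<open>The identity has trivial kernel, so its moments are exactly the limits just
      found.\<close>
    have "kernel \<Gamma> \<Gamma> (\<lambda>x. x) = {\<one>\<^bsub>\<Gamma>\<^esub>}" by (auto simp: kernel_def)
    then have eq: "group_hom.spectral_integral \<Gamma> \<Gamma> (\<lambda>x. x) f I (poly p) =
        (\<Sum>i\<le>degree p. coeff p i * Re (\<Gamma>.conv_pow (\<Gamma>.sq_abs f) i \<one>\<^bsub>\<Gamma>\<^esub>))"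
      by (simp add: group_hom.spectral_integral_poly[OF id f real_spectrum_id I(1)])
    show "(\<lambda>n. group_hom.spectral_integral \<Gamma> (\<Gamma>' n) (\<phi> n) f I (poly p)) \<longlonglongrightarrow> group_hom.spectral_integral \<Gamma> \<Gamma> (\<lambda>x. x) f I (poly p)"
      unfolding eq
      by (rule Lim_transform_eventually[OF lim])
         (use group_hom.spectral_integral_poly[OF hom f real_spectrum I(1)] in
           \<open>auto intro!: eventually_mono[OF eventually_ge_at_top[of 1]]\<close>)
  next
    show "\<bar>group_hom.spectral_integral \<Gamma> \<Gamma> (\<lambda>x. x) f I u - group_hom.spectral_integral \<Gamma> \<Gamma> (\<lambda>x. x) f I (poly p)\<bar> \<le> \<delta>"
      if "\<And>t. t \<in> I \<Longrightarrow> \<bar>u t - poly p t\<bar> \<le> \<delta>" for p \<delta>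
      using group_hom.spectral_integral_diff_le[OF id f real_spectrum_id I that] .
  next
    show "\<bar>group_hom.spectral_integral \<Gamma> (\<Gamma>' n) (\<phi> n) f I u
        - group_hom.spectral_integral \<Gamma> (\<Gamma>' n) (\<phi> n) f I (poly p)\<bar> \<le> \<delta>"
      if "n \<ge> 1" "\<And>t. t \<in> I \<Longrightarrow> \<bar>u t - poly p t\<bar> \<le> \<delta>" for n p \<delta>
      using group_hom.spectral_integral_diff_le[OF hom[OF that(1)] f real_spectrum[OF that(1)] I that(2)] .
  qed
qed

theorem theorem17:
  fixes \<Gamma> :: "('g, 'm) monoid_scheme"
    and \<Gamma>' :: "nat \<Rightarrow> ('h, 'k) monoid_scheme"
    and \<phi> :: "nat \<Rightarrow> 'g \<Rightarrow> 'h"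
  assumes "group \<Gamma>" and "countable (carrier \<Gamma>)"
    and "\<And>n. n \<ge> 1 \<Longrightarrow> group (\<Gamma>' n)"
    and "\<And>n. n \<ge> 1 \<Longrightarrow> \<phi> n \<in> hom \<Gamma> (\<Gamma>' n)"
    and "subgroups_tend_to_one \<Gamma> (\<lambda>n. kernel \<Gamma> (\<Gamma>' n) (\<phi> n))"
  shows "(\<forall>f \<in> Lp 1 \<Gamma>.
            limsup (\<lambda>n. ereal (fk_det (\<Gamma>' n) (L1_op (\<Gamma>' n) (pushforward \<Gamma> (\<phi> n) f))))
              \<le> ereal (fk_det \<Gamma> (L1_op \<Gamma> f))) \<and>
         (\<forall>f \<in> Units (L1_monoid \<Gamma>).
            (\<lambda>n. fk_det (\<Gamma>' n) (L1_op (\<Gamma>' n) (pushforward \<Gamma> (\<phi> n) f)))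
              \<longlonglongrightarrow> fk_det \<Gamma> (L1_op \<Gamma> f))"
proof (intro conjI ballI)
  interpret \<Gamma>: group \<Gamma> by fact
  have id: "group_hom \<Gamma> \<Gamma> (\<lambda>x. x)" by unfold_locales (auto simp: hom_def)
  have hom: "group_hom \<Gamma> (\<Gamma>' n) (\<phi> n)" if "n \<ge> 1" for n
    using assms that by (simp add: group_hom_def group_hom_axioms_def)
  fix f assume f: "f \<in> Lp 1 \<Gamma>"
  let ?I = "{0..(l1_norm \<Gamma> f)\<^sup>2}"
  let ?u = "\<lambda>\<epsilon> t. ln (sqrt t + \<epsilon>)"
  have I: "?I \<subseteq> {0..}" by auto
  note real_spectrum = group_hom.real_spectrum_sq_abs_0[OF hom f] and real_spectrum_id = group_hom.real_spectrum_sq_abs_0[OF id f]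
  \<comment> \<open>\<epsilon> is fixed while \<open>n\<close> grows, so the integrand is continuous
    on the whole interval, including 0.\<close>
  have le: "limsup (\<lambda>n. ereal (fk_det (\<Gamma>' n) (L1_op (\<Gamma>' n) (pushforward \<Gamma> (\<phi> n) f))))
      \<le> ereal (exp (group_hom.spectral_integral \<Gamma> \<Gamma> (\<lambda>x. x) f ?I (?u \<epsilon>)))" if \<epsilon>: "\<epsilon> > 0" for \<epsilon>
  proof -
    have "sqrt t + \<epsilon> > 0" if "t \<in> ?I" for t using that \<epsilon> by (auto intro: add_nonneg_pos)
    then have "continuous_on ?I (?u \<epsilon>)" by (intro continuous_intros) force
    from spectral_integral_tendsto[OF assms(1) hom assms(5) f compact_Icc this real_spectrum real_spectrum_id]
    have "(\<lambda>n. ereal (exp (group_hom.spectral_integral \<Gamma> (\<Gamma>' n) (\<phi> n) f ?I (?u \<epsilon>))))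
        \<longlonglongrightarrow> ereal (exp (group_hom.spectral_integral \<Gamma> \<Gamma> (\<lambda>x. x) f ?I (?u \<epsilon>)))"
      by (intro tendsto_ereal tendsto_exp)
    from lim_imp_Limsup[OF _ this]
    have "limsup (\<lambda>n. ereal (exp (group_hom.spectral_integral \<Gamma> (\<Gamma>' n) (\<phi> n) f ?I (?u \<epsilon>))))
        = ereal (exp (group_hom.spectral_integral \<Gamma> \<Gamma> (\<lambda>x. x) f ?I (?u \<epsilon>)))" by simp
    moreover have "limsup (\<lambda>n. ereal (fk_det (\<Gamma>' n) (L1_op (\<Gamma>' n) (pushforward \<Gamma> (\<phi> n) f))))
        \<le> limsup (\<lambda>n. ereal (exp (group_hom.spectral_integral \<Gamma> (\<Gamma>' n) (\<phi> n) f ?I (?u \<epsilon>))))"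
      using group_hom.fk_det_le_spectral_integral[OF hom f real_spectrum compact_Icc I \<epsilon>]
      by (intro Limsup_mono eventually_mono[OF eventually_ge_at_top[of 1]]) auto
    ultimately show ?thesis by simp
  qed
  show "limsup (\<lambda>n. ereal (fk_det (\<Gamma>' n) (L1_op (\<Gamma>' n) (pushforward \<Gamma> (\<phi> n) f))))
      \<le> ereal (fk_det \<Gamma> (L1_op \<Gamma> f))"
  \<comment> \<open>Only now does \<epsilon> tend to 0, and only in the bound for the original
    group, which converges to its determinant.\<close>
  proof (rule tendsto_lowerbound)
    show "((\<lambda>\<epsilon>. ereal (exp (group_hom.spectral_integral \<Gamma> \<Gamma> (\<lambda>x. x) f ?I (?u \<epsilon>)))) \<longlongrightarrow> ereal (fk_det \<Gamma> (L1_op \<Gamma> f))) (at_right 0)"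
      using group_hom.fk_det_tendsto_spectral_integral[OF id f real_spectrum_id compact_Icc I]
      by (intro tendsto_ereal) (simp only: pushforward_id[OF f])
    show "\<forall>\<^sub>F \<epsilon> in at_right 0. limsup (\<lambda>n. ereal (fk_det (\<Gamma>' n) (L1_op (\<Gamma>' n) (pushforward \<Gamma> (\<phi> n) f))))
        \<le> ereal (exp (group_hom.spectral_integral \<Gamma> \<Gamma> (\<lambda>x. x) f ?I (?u \<epsilon>)))"
      using le by (intro eventually_mono[OF eventually_at_right_less[of 0]]) auto
  qed simp
next
  interpret \<Gamma>: group \<Gamma> by fact
  have id: "group_hom \<Gamma> \<Gamma> (\<lambda>x. x)" by unfold_locales (auto simp: hom_def)
  have hom: "group_hom \<Gamma> (\<Gamma>' n) (\<phi> n)" if "n \<ge> 1" for n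
    using assms that by (simp add: group_hom_def group_hom_axioms_def)
  fix f assume "f \<in> Units (L1_monoid \<Gamma>)"
  then obtain k where f: "f \<in> Lp 1 \<Gamma>" and k: "k \<in> Lp 1 \<Gamma>" "convolution \<Gamma> k f = delta \<one>\<^bsub>\<Gamma>\<^esub>"
    by (auto simp: Units_def L1_monoid_def)
  define c where "c = inverse (l1_norm \<Gamma> k)"
  let ?I = "{c\<^sup>2..(l1_norm \<Gamma> f)\<^sup>2}"
  have c: "c > 0" using group_hom.real_spectrum_sq_abs_unit(2)[OF id f k] by (simp add: c_def)
  have I: "?I \<subseteq> {c\<^sup>2..}" by auto
  note real_spectrum = group_hom.real_spectrum_sq_abs_unit(1)[OF hom f k, folded c_def]
    and real_spectrum_id = group_hom.real_spectrum_sq_abs_unit(1)[OF id f k, folded c_def]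
  \<comment> \<open>The left end of the interval is positive, so ln of the square root is continuous
    up to both ends and no shift intervenes.\<close>
  have "t > 0" if "t \<in> ?I" for t
    by (rule less_le_trans[OF zero_less_power[OF c, of 2]]) (use that in simp)
  then have "continuous_on ?I (\<lambda>t. ln (sqrt t))" by (intro continuous_intros) force
  from spectral_integral_tendsto[OF assms(1) hom assms(5) f compact_Icc this real_spectrum real_spectrum_id]
  have lim: "(\<lambda>n. exp (group_hom.spectral_integral \<Gamma> (\<Gamma>' n) (\<phi> n) f ?I (\<lambda>t. ln (sqrt t))))
      \<longlonglongrightarrow> exp (group_hom.spectral_integral \<Gamma> \<Gamma> (\<lambda>x. x) f ?I (\<lambda>t. ln (sqrt t)))"
    by (intro tendsto_exp)
  have "fk_det \<Gamma> (L1_op \<Gamma> f) = exp (group_hom.spectral_integral \<Gamma> \<Gamma> (\<lambda>x. x) f ?I (\<lambda>t. ln (sqrt t)))"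
    using group_hom.fk_det_eq_spectral_integral[OF id f real_spectrum_id compact_Icc I c] by (simp only: pushforward_id[OF f])
  \<comment> \<open>The formula for the determinants is available from index 1 on, which is enough
    for the limit.\<close>
  then show "(\<lambda>n. fk_det (\<Gamma>' n) (L1_op (\<Gamma>' n) (pushforward \<Gamma> (\<phi> n) f))) \<longlonglongrightarrow> fk_det \<Gamma> (L1_op \<Gamma> f)"
    using group_hom.fk_det_eq_spectral_integral[OF hom f real_spectrum compact_Icc I c]
    by (intro Lim_transform_eventually[OF lim[folded \<open>_ = exp _\<close>]])
       (auto intro!: eventually_mono[OF eventually_ge_at_top[of 1]])
qed

end
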